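(* Let $\sigma>0$, $R\ge 0$, $P\ge 0$. If $P\ge 2^{2R}-1$, then $$\mathrm{MMSE}(P,R)\;\ge\;\inf_{\sigma_{XV}}\ \sup_{\gamma\in\mathbb{R}\setminus\{0\}}\ \frac{1}{\gamma^2}\left(\left(\sqrt{\frac{\sigma^2 2^{2R}}{1+\sigma^2+P+2\sigma_{XV}}}-\sqrt{(1-\gamma)^2\sigma^2+\gamma^2P-2\gamma(1-\gamma)\sigma_{XV}}\right)^+\right)^2,$$ where the infimum is over all real $\sigma_{XV}$ with $$\max\left\{-\sigma\sqrt{P},\ \frac{2^{2R}-1-P-\sigma^2}{2}\right\}\le\sigma_{XV}\le\sigma\sqrt{P}.$$ If $P<2^{2R}-1$, then reliable communication at rate $R$ is not possible: there is no sequence of encoder/decoder maps satisfying the power constraint $P$ whose message error probability tends to $0$ as $m\to\infty$.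
   Context: Problem setting. For each blocklength $m$, the host signal $\mathbf{X}_0^m\sim\mathcal{N}(0,\sigma^2\mathbb{I})$ takes values in $\mathbb{R}^m$; the message $M$ is independent of $\mathbf{X}_0^m$ and uniform on $\{1,2,\ldots,2^{mR}\}$. An encoder $\mathcal{E}_m$ maps $(M,\mathbf{X}_0^m)$ to the modified host signal $\mathbf{X}_1^m=\mathbf{X}_0^m+\mathbf{V}^m\in\mathbb{R}^m$, subject to the average power constraint (for each message) $\mathbb{E}[\|\mathbf{X}_0^m-\mathbf{X}_1^m\|^2]\le mP$. The channel outputs $\mathbf{Y}^m=\mathbf{X}_1^m+\mathbf{Z}^m$, where $\mathbf{Z}^m\sim\mathcal{N}(0,\mathbb{I})$ is independent of $(M,\mathbf{X}_0^m)$. A decoder $\mathcal{D}_m$ maps $\mathbf{Y}^m$ to a pair $(\widehat{\mathbf{X}}_1^m,\widehat{M})$ of estimates of $\mathbf{X}_1^m$ and $M$. Error probability: $\epsilon_m(\mathcal{E}_m,\mathcal{D}_m)=\Pr(M\ne\widehat{M})$. Distortion: $d(\mathbf{x}^m,\mathbf{y}^m)=\frac1m\|\mathbf{x}^m-\mathbf{y}^m\|^2$. Define $$\mathrm{MMSE}(P,R)=\inf\ \limsup_{m\to\infty}\ \mathbb{E}[d(\mathbf{X}_1^m,\widehat{\mathbf{X}}_1^m)],$$ where the infimum is over all sequences $\{\mathcal{E}_m,\mathcal{D}_m\}_{m\ge1}$ satisfying the power constraint $P$ with $\epsilon_m(\mathcal{E}_m,\mathcal{D}_m)\to0$. Notation: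 $(a)^+=\max\{a,0\}$. *)

theory Defs
  imports "HOL-Probability.Probability"
begin

text \<open>
  Since the blocklength \<open>m\<close> varies, a vector of \<open>\<real>\<^sup>m\<close> is a function
  \<open>nat \<Rightarrow> real\<close> that is \<open>undefined\<close> outside \<open>{..<m}\<close>, i.e. a point of the product space below.
\<close>

definition Rm :: "nat \<Rightarrow> (nat \<Rightarrow> real) measure" where
  "Rm m = (\<Pi>\<^sub>M i\<in>{..<m}. borel)"

text \<open>\<open>gauss m s\<close> is \<open>\<N>(0, s\<^sup>2 I)\<close> on \<open>\<real>\<^sup>m\<close>; its parameter is the standard deviation.\<close>

definition gauss :: "nat \<Rightarrow> real \<Rightarrow> (nat \<Rightarrow> real) measure" where
  "gauss m s = (\<Pi>\<^sub>M i\<in>{..<m}. density lborel (\<lambda>x. ennreal (normal_density 0 s x)))"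

definition vadd :: "nat \<Rightarrow> (nat \<Rightarrow> real) \<Rightarrow> (nat \<Rightarrow> real) \<Rightarrow> (nat \<Rightarrow> real)" where
  "vadd m x y = (\<lambda>i\<in>{..<m}. x i + y i)"

definition sqdist :: "nat \<Rightarrow> (nat \<Rightarrow> real) \<Rightarrow> (nat \<Rightarrow> real) \<Rightarrow> real" where
  "sqdist m x y = (\<Sum>i<m. (x i - y i)\<^sup>2)"

definition distortion :: "nat \<Rightarrow> (nat \<Rightarrow> real) \<Rightarrow> (nat \<Rightarrow> real) \<Rightarrow> real" where
  "distortion m x y = 1 / real m * sqdist m x y"

text \<open>The integers \<open>k\<close> with \<open>1 \<le> k \<le> 2\<^sup>m\<^sup>R\<close>; the bound itself need not be an integer.\<close>

definition messages :: "real \<Rightarrow> nat \<Rightarrow> nat set" where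
  "messages R m = {1..nat \<lfloor>2 powr (real m * R)\<rfloor>}"

type_synonym encoder = "nat \<times> (nat \<Rightarrow> real) \<Rightarrow> (nat \<Rightarrow> real)"
type_synonym decoder = "(nat \<Rightarrow> real) \<Rightarrow> (nat \<Rightarrow> real) \<times> nat"

definition is_encoder :: "real \<Rightarrow> nat \<Rightarrow> encoder \<Rightarrow> bool" where
  "is_encoder R m enc \<longleftrightarrow> enc \<in> count_space (messages R m) \<Otimes>\<^sub>M Rm m \<rightarrow>\<^sub>M Rm m"

definition is_decoder :: "real \<Rightarrow> nat \<Rightarrow> decoder \<Rightarrow> bool" where
  "is_decoder R m dec \<longleftrightarrow> dec \<in> Rm m \<rightarrow>\<^sub>M Rm m \<Otimes>\<^sub>M count_space (messages R m)"

text \<open>The power constraint is imposed for each message; the expectation is over the host signal.\<close>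

definition power_constraint ::
  "real \<Rightarrow> real \<Rightarrow> real \<Rightarrow> nat \<Rightarrow> encoder \<Rightarrow> bool" where
  "power_constraint \<sigma> P R m enc \<longleftrightarrow>
     (\<forall>k\<in>messages R m.
        (\<integral>\<^sup>+ x0. ennreal (sqdist m x0 (enc (k, x0))) \<partial>gauss m \<sigma>) \<le> ennreal (real m * P))"

text \<open>
  The joint law of the independent triple (message, host signal, channel noise). All random
  quantities are functions of a point \<open>\<omega> = (k, x0, z)\<close> of this space.
\<close>

definition joint :: "real \<Rightarrow> real \<Rightarrow> nat \<Rightarrow> (nat \<times> (nat \<Rightarrow> real) \<times> (nat \<Rightarrow> real)) measure" where
  "joint \<sigma> R m = uniform_count_measure (messages R m) \<Otimes>\<^sub>M (gauss m \<sigma> \<Otimes>\<^sub>M gauss m 1)"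

definition X1 :: "encoder \<Rightarrow> nat \<times> (nat \<Rightarrow> real) \<times> (nat \<Rightarrow> real) \<Rightarrow> (nat \<Rightarrow> real)" where
  "X1 enc = (\<lambda>(k, x0, z). enc (k, x0))"

definition Y :: "nat \<Rightarrow> encoder \<Rightarrow> nat \<times> (nat \<Rightarrow> real) \<times> (nat \<Rightarrow> real) \<Rightarrow> (nat \<Rightarrow> real)" where
  "Y m enc = (\<lambda>(k, x0, z). vadd m (X1 enc (k, x0, z)) z)"

definition error_prob :: "real \<Rightarrow> real \<Rightarrow> nat \<Rightarrow> encoder \<Rightarrow> decoder \<Rightarrow> real" where
  "error_prob \<sigma> R m enc dec = \<P>(\<omega> in joint \<sigma> R m. fst \<omega> \<noteq> snd (dec (Y m enc \<omega>)))"

definition expected_distortion :: "real \<Rightarrow> real \<Rightarrow> nat \<Rightarrow> encoder \<Rightarrow> decoder \<Rightarrow> ennreal" where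
  "expected_distortion \<sigma> R m enc dec =
     (\<integral>\<^sup>+ \<omega>. ennreal (distortion m (X1 enc \<omega>) (fst (dec (Y m enc \<omega>)))) \<partial>joint \<sigma> R m)"

definition reliable_codes ::
  "real \<Rightarrow> real \<Rightarrow> real \<Rightarrow> ((nat \<Rightarrow> encoder) \<times> (nat \<Rightarrow> decoder)) set" where
  "reliable_codes \<sigma> P R =
     {(enc, dec).
        (\<forall>m\<ge>1. is_encoder R m (enc m) \<and> is_decoder R m (dec m) \<and>
               power_constraint \<sigma> P R m (enc m)) \<and>
        (\<lambda>m. error_prob \<sigma> R m (enc m) (dec m)) \<longlonglongrightarrow> 0}"

text \<open>Extended-valued: the infimum is \<open>\<infinity>\<close> if there is no reliable sequence of codes.\<close>

definition MMSE :: "real \<Rightarrow> real \<Rightarrow> real \<Rightarrow> ennreal" where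
  "MMSE \<sigma> P R =
     (INF (enc, dec)\<in>reliable_codes \<sigma> P R.
        limsup (\<lambda>m. expected_distortion \<sigma> R m (enc m) (dec m)))"

definition pos_part :: "real \<Rightarrow> real" where
  "pos_part a = max a 0"

end

theory Submission
  imports Defs
begin

text \<open>
  The converse is a single change of measure. Let \<open>f(k, x\<^sub>0, y)\<close> be the true joint density of message,
  host and channel output, and compare it with
  \<open>g(k, x\<^sub>0, y) = N(y; 0, S) w(k | y) N(x\<^sub>0; u(y), D)\<close>, where \<open>u(y)\<close> is any estimate of the host and
  \<open>w(\<cdot> | y)\<close> is half a point mass at the decoded message and half uniform on the \<open>K\<close> messages.
  Since \<open>\<integral> g = 1\<close>, \<open>E ln (g/f) \<le> 0\<close>; if \<open>E|Y|\<^sup>2 \<le> mS\<close> and \<open>E|X\<^sub>0 - u(Y)|\<^sup>2 \<le> mD\<close> this reads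
  \<open>S D \<ge> \<sigma>\<^sup>2 exp ((2/m) ((1 - \<epsilon>) ln K - ln 2))\<close>, whose right-hand side tends to \<open>\<sigma>\<^sup>2 2\<^sup>2\<^sup>R\<close>.

  With \<open>c = E\<langle>X\<^sub>0, V\<rangle> / m\<close> one may take \<open>S = 1 + \<sigma>\<^sup>2 + P + 2c\<close>. The estimate \<open>u = 0\<close> gives the lower
  constraint on \<open>c\<close>; the best linear estimate from \<open>y\<close> gives \<open>1 + P \<ge> 2\<^sup>2\<^sup>R\<close>; and \<open>u = \<gamma> \<cdot>\<close> (the decoder's
  estimate of \<open>X\<^sub>1\<close>), with the triangle inequality in \<open>L\<^sup>2\<close>, gives the distortion bound.
  Compactness of the range of \<open>c\<close> then allows passing to the limit along a subsequence.
\<close>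

section \<open>Lebesgue and Gaussian measures on \<open>\<real>\<^sup>m\<close>\<close>

interpretation lborel_product: product_sigma_finite "\<lambda>_::nat. lborel :: real measure"
  by standard

text \<open>\<open>Rm m\<close> only supplies the sigma-algebra, since \<open>borel\<close> carries
  no Lebesgue measure; densities are taken with respect to this measure on the same measurable
  sets.\<close>

definition lebesgue_vec :: "nat \<Rightarrow> (nat \<Rightarrow> real) measure" where
  "lebesgue_vec m = (\<Pi>\<^sub>M i\<in>{..<m}. lborel)"

text \<open>The restriction makes this a point of \<open>Rm m\<close>, whose elements are
  \<open>undefined\<close> outside \<open>{..<m}\<close>.\<close>

definition zero_vec :: "nat \<Rightarrow> nat \<Rightarrow> real" where
  "zero_vec m = (\<lambda>i\<in>{..<m}. 0)"

text \<open>Here \<open>v\<close> is the variance, whereas \<open>gauss\<close> takes the standard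
  deviation.\<close>

definition gauss_density :: "nat \<Rightarrow> (nat \<Rightarrow> real) \<Rightarrow> real \<Rightarrow> (nat \<Rightarrow> real) \<Rightarrow> real" where
  "gauss_density m a v x = (\<Prod>i<m. normal_density (a i) (sqrt v) (x i))"

lemma sets_Rm_lebesgue_vec [measurable_cong]: "sets (lebesgue_vec m) = sets (Rm m)"
  unfolding lebesgue_vec_def Rm_def by (intro sets_PiM_cong) auto

lemma sets_gauss [measurable_cong]: "sets (gauss m s) = sets (Rm m)"
  unfolding gauss_def Rm_def by (intro sets_PiM_cong) auto

lemma sigma_finite_lebesgue_vec: "sigma_finite_measure (lebesgue_vec m)"
  unfolding lebesgue_vec_def by (rule lborel_product.sigma_finite) simp

lemma measurable_component_Rm [measurable]: "i < m \<Longrightarrow> (\<lambda>x. x i) \<in> borel_measurable (Rm m)"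
  unfolding Rm_def by (rule measurable_component_singleton) simp

lemma measurable_component_comp_Rm:
  assumes "f \<in> N \<rightarrow>\<^sub>M Rm m" "i < m"
  shows "(\<lambda>w. f w i) \<in> borel_measurable N"
  using measurable_compose[OF assms(1) measurable_component_Rm[OF assms(2)]] .

lemma zero_vec_in_Rm [measurable]: "zero_vec m \<in> space (Rm m)"
  by (auto simp: zero_vec_def Rm_def space_PiM)

lemma measurable_vadd [measurable]:
  assumes [measurable]: "f \<in> N \<rightarrow>\<^sub>M Rm m" "g \<in> N \<rightarrow>\<^sub>M Rm m"
  shows "(\<lambda>w. vadd m (f w) (g w)) \<in> N \<rightarrow>\<^sub>M Rm m"
  unfolding vadd_def Rm_def
  by (rule measurable_restrict)
     (use measurable_component_comp_Rm[OF assms(1)] measurable_component_comp_Rm[OF assms(2)] in auto)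

lemma measurable_sqdist [measurable]:
  assumes [measurable]: "f \<in> N \<rightarrow>\<^sub>M Rm m" "g \<in> N \<rightarrow>\<^sub>M Rm m"
  shows "(\<lambda>w. sqdist m (f w) (g w)) \<in> borel_measurable N"
  unfolding sqdist_def
  using measurable_component_comp_Rm[OF assms(1)] measurable_component_comp_Rm[OF assms(2)]
  by (intro borel_measurable_sum borel_measurable_power borel_measurable_diff) auto

lemma measurable_gauss_density [measurable]:
  assumes [measurable]: "f \<in> N \<rightarrow>\<^sub>M Rm m" "g \<in> N \<rightarrow>\<^sub>M Rm m"
  shows "(\<lambda>w. gauss_density m (f w) v (g w)) \<in> borel_measurable N"
proof -
  have *: "(\<lambda>w. normal_density (f w i) (sqrt v) (g w i)) \<in> borel_measurable N" if "i < m" for i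
    unfolding normal_density_def
    using measurable_component_comp_Rm[OF assms(1) that]
      measurable_component_comp_Rm[OF assms(2) that] by measurable
  show ?thesis
    unfolding gauss_density_def by (rule borel_measurable_prod) (use * in auto)
qed

lemma gauss_density_pos: "v > 0 \<Longrightarrow> gauss_density m a v x > 0"
  unfolding gauss_density_def by (intro prod_pos) (auto intro!: normal_density_pos)

lemma ln_gauss_density:
  assumes "v > 0"
  shows "ln (gauss_density m a v x) = - (real m / 2 * ln (2 * pi * v)) - sqdist m x a / (2 * v)"
proof -
  have "ln (normal_density (a i) (sqrt v) (x i)) = - (ln (2 * pi * v) / 2) - (x i - a i)\<^sup>2 / (2 * v)" for i
    using assms by (simp add: normal_density_def ln_mult ln_div ln_sqrt)
  moreover have "ln (gauss_density m a v x) = (\<Sum>i<m. ln (normal_density (a i) (sqrt v) (x i)))"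
    unfolding gauss_density_def
    using assms by (intro ln_prod) (simp_all add: normal_density_pos less_imp_neq[THEN not_sym])
  ultimately show ?thesis
    by (simp add: sqdist_def sum_subtractf sum_divide_distrib sum_negf)
qed

lemma nn_integral_gauss_density:
  assumes "v > 0"
  shows "(\<integral>\<^sup>+x. ennreal (gauss_density m a v x) \<partial>lebesgue_vec m) = 1"
proof -
  have "(\<integral>\<^sup>+x. ennreal (gauss_density m a v x) \<partial>lebesgue_vec m)
      = (\<integral>\<^sup>+x. (\<Prod>i<m. ennreal (normal_density (a i) (sqrt v) (x i))) \<partial>lebesgue_vec m)"
    unfolding gauss_density_def by (simp add: prod_ennreal)
  also have "\<dots> = (\<Prod>i<m. \<integral>\<^sup>+y. ennreal (normal_density (a i) (sqrt v) y) \<partial>lborel)"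
    unfolding lebesgue_vec_def by (rule lborel_product.product_nn_integral_prod) auto
  also have "\<dots> = 1"
    using assms by (intro prod.neutral) (simp add: nn_integral_eq_integral)
  finally show ?thesis .
qed

text \<open>A product measure is determined by its values on boxes, and on a box both the density
  and the indicator split into factors of one coordinate each.\<close>

lemma gauss_eq_density:
  assumes "s > 0"
  shows "gauss m s = density (lebesgue_vec m) (\<lambda>x. ennreal (gauss_density m (zero_vec m) (s\<^sup>2) x))"
    (is "_ = ?D")
proof -
  interpret N: product_sigma_finite "\<lambda>_::nat. density lborel (\<lambda>x. ennreal (normal_density 0 s x))"
    using prob_space_normal_density[OF assms]
    by (intro product_sigma_finite.intro prob_space_imp_sigma_finite)
  have "?D = (\<Pi>\<^sub>M i\<in>{..<m}. density lborel (\<lambda>x. ennreal (normal_density 0 s x)))"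
  proof (rule N.PiM_eqI)
    show "sets ?D = sets (\<Pi>\<^sub>M i\<in>{..<m}. density lborel (\<lambda>x. ennreal (normal_density 0 s x)))"
      using sets_gauss[of m s] sets_Rm_lebesgue_vec[of m] by (simp add: gauss_def)
    fix A assume "\<And>i. i \<in> {..<m} \<Longrightarrow> A i \<in> sets (density lborel (\<lambda>x. ennreal (normal_density 0 s x)))"
    then have A: "A i \<in> sets borel" if "i < m" for i using that by simp
    have "Pi\<^sub>E {..<m} A \<in> sets (lebesgue_vec m)"
      unfolding lebesgue_vec_def by (rule sets_PiM_I_finite) (use A in auto)
    moreover have "(\<lambda>x. gauss_density m (zero_vec m) (s\<^sup>2) x) \<in> borel_measurable (lebesgue_vec m)"
      by measurable
    ultimately have "emeasure ?D (Pi\<^sub>E {..<m} A)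
       = (\<integral>\<^sup>+x. ennreal (gauss_density m (zero_vec m) (s\<^sup>2) x) * indicator (Pi\<^sub>E {..<m} A) x \<partial>lebesgue_vec m)"
      by (intro emeasure_density) auto
    also have "\<dots> = (\<integral>\<^sup>+x. (\<Prod>i<m. ennreal (normal_density 0 s (x i)) * indicator (A i) (x i)) \<partial>lebesgue_vec m)"
    proof (rule nn_integral_cong)
      fix x assume "x \<in> space (lebesgue_vec m)"
      \<comment> \<open>Lying in the box also requires extensionality, which every point of the
        space has; what remains is one condition per coordinate.\<close>
      then have x: "x \<in> extensional {..<m}" by (auto simp: lebesgue_vec_def space_PiM PiE_def)
      then have "indicator (Pi\<^sub>E {..<m} A) x = (\<Prod>i<m. indicator (A i) (x i) :: ennreal)"
        by (auto simp: indicator_def PiE_def Pi_def prod_zero_iff)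
      then show "ennreal (gauss_density m (zero_vec m) (s\<^sup>2) x) * indicator (Pi\<^sub>E {..<m} A) x
        = (\<Prod>i<m. ennreal (normal_density 0 s (x i)) * indicator (A i) (x i))"
        using assms by (simp add: gauss_density_def zero_vec_def prod.distrib prod_ennreal)
    qed
    also have "\<dots> = (\<Prod>i<m. \<integral>\<^sup>+y. ennreal (normal_density 0 s y) * indicator (A i) y \<partial>lborel)"
      unfolding lebesgue_vec_def
      by (rule lborel_product.product_nn_integral_prod) (use A in auto)
    also have "\<dots> = (\<Prod>i<m. emeasure (density lborel (\<lambda>x. ennreal (normal_density 0 s x))) (A i))"
      using A by (intro prod.cong refl) (simp add: emeasure_density)
    finally show "emeasure ?D (Pi\<^sub>E {..<m} A)
       = (\<Prod>i\<in>{..<m}. emeasure (density lborel (\<lambda>x. ennreal (normal_density 0 s x))) (A i))" .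
  qed simp
  then show ?thesis by (simp add: gauss_def)
qed

text \<open>Translation invariance is checked on boxes, where it reduces to that of
  \<open>lborel\<close> on the line. It turns an integral over the noise into one over the channel
  output.\<close>

lemma nn_integral_lebesgue_vec_vadd:
  assumes [measurable]: "f \<in> borel_measurable (Rm m)"
  shows "(\<integral>\<^sup>+z. f (vadd m a z) \<partial>lebesgue_vec m) = (\<integral>\<^sup>+y. f y \<partial>lebesgue_vec m)"
proof -
  have vm: "vadd m a \<in> lebesgue_vec m \<rightarrow>\<^sub>M lebesgue_vec m"
    unfolding vadd_def lebesgue_vec_def
  proof (rule measurable_restrict)
    fix i assume "i \<in> {..<m}"
    then have [measurable]: "(\<lambda>x. x i) \<in> borel_measurable (\<Pi>\<^sub>M i\<in>{..<m}. lborel)"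
      using measurable_component_singleton[of i "{..<m}" "\<lambda>_. lborel :: real measure"] by simp
    show "(\<lambda>x. a i + x i) \<in> (\<Pi>\<^sub>M i\<in>{..<m}. lborel) \<rightarrow>\<^sub>M lborel"
      by measurable
  qed
  have "distr (lebesgue_vec m) (lebesgue_vec m) (vadd m a) = (\<Pi>\<^sub>M i\<in>{..<m}. lborel)"
  proof (rule lborel_product.PiM_eqI)
    fix A assume "\<And>i. i \<in> {..<m} \<Longrightarrow> A i \<in> sets (lborel :: real measure)"
    then have A: "A i \<in> sets borel" if "i < m" for i using that by simp
    then have "Pi\<^sub>E {..<m} A \<in> sets (lebesgue_vec m)"
      unfolding lebesgue_vec_def by (intro sets_PiM_I_finite) auto
    with vm have "emeasure (distr (lebesgue_vec m) (lebesgue_vec m) (vadd m a)) (Pi\<^sub>E {..<m} A)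
      = emeasure (lebesgue_vec m) (vadd m a -` Pi\<^sub>E {..<m} A \<inter> space (lebesgue_vec m))"
      by (rule emeasure_distr)
    also have "vadd m a -` Pi\<^sub>E {..<m} A \<inter> space (lebesgue_vec m) = Pi\<^sub>E {..<m} (\<lambda>i. (+) (a i) -` A i)"
      by (auto simp: vadd_def lebesgue_vec_def space_PiM PiE_def Pi_def)
    also have "emeasure (lebesgue_vec m) \<dots> = (\<Prod>i<m. emeasure lborel ((+) (a i) -` A i))"
      unfolding lebesgue_vec_def
    proof (rule lborel_product.emeasure_PiM)
      fix i assume "i \<in> {..<m}"
      then show "(+) (a i) -` A i \<in> sets lborel"
        using A[of i] measurable_sets_borel[of "(+) (a i)" borel "A i"] by auto
    qed simp
    also have "\<dots> = (\<Prod>i<m. emeasure lborel (A i))"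
    proof (rule prod.cong[OF refl])
      fix i assume "i \<in> {..<m}"
      then have "emeasure (distr lborel borel ((+) (a i))) (A i) = emeasure lborel ((+) (a i) -` A i)"
        using A[of i] by (subst emeasure_distr) auto
      then show "emeasure lborel ((+) (a i) -` A i) = emeasure lborel (A i)"
        by (simp add: lborel_distr_plus)
    qed
    finally show "emeasure (distr (lebesgue_vec m) (lebesgue_vec m) (vadd m a)) (Pi\<^sub>E {..<m} A)
      = (\<Prod>i\<in>{..<m}. emeasure lborel (A i))" .
  qed (simp_all add: lebesgue_vec_def)
  then have *: "distr (lebesgue_vec m) (lebesgue_vec m) (vadd m a) = lebesgue_vec m"
    by (simp add: lebesgue_vec_def)
  have "(\<integral>\<^sup>+y. f y \<partial>distr (lebesgue_vec m) (lebesgue_vec m) (vadd m a))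
      = (\<integral>\<^sup>+z. f (vadd m a z) \<partial>lebesgue_vec m)"
    by (rule nn_integral_distr[OF vm]) simp
  then show ?thesis by (simp add: *)
qed

section \<open>Moments of the Gaussian measure\<close>

lemma prob_space_gauss: "s > 0 \<Longrightarrow> prob_space (gauss m s)"
  unfolding gauss_def by (intro prob_space_PiM prob_space_normal_density)

lemma distr_gauss_component:
  assumes "s > 0" "i < m"
  shows "distr (gauss m s) borel (\<lambda>x. x i) = density lborel (\<lambda>x. ennreal (normal_density 0 s x))"
proof -
  have "distr (gauss m s) (density lborel (\<lambda>x. ennreal (normal_density 0 s x))) (\<lambda>x. x i)
     = density lborel (\<lambda>x. ennreal (normal_density 0 s x))"
    unfolding gauss_def
    by (rule distr_PiM_component) (use assms prob_space_normal_density in auto)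
  moreover have "distr (gauss m s) borel (\<lambda>x. x i)
      = distr (gauss m s) (density lborel (\<lambda>x. ennreal (normal_density 0 s x))) (\<lambda>x. x i)"
    by (rule distr_cong) auto
  ultimately show ?thesis by simp
qed

lemma gauss_component_power:
  assumes "s > 0" "i < m"
  shows "integrable (gauss m s) (\<lambda>x. x i ^ k)"
    and "(\<integral>x. x i ^ k \<partial>gauss m s) = (\<integral>x. normal_density 0 s x * x ^ k \<partial>lborel)"
proof -
  have [measurable]: "(\<lambda>x. x i) \<in> gauss m s \<rightarrow>\<^sub>M borel"
    using measurable_component_Rm[OF assms(2)] by measurable
  have "integrable (distr (gauss m s) borel (\<lambda>x. x i)) (\<lambda>x. x ^ k)"
    using integrable_normal_moment[OF assms(1), of 0 k] unfolding distr_gauss_component[OF assms]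
    by (subst integrable_density) auto
  then show "integrable (gauss m s) (\<lambda>x. x i ^ k)"
    by (subst (asm) integrable_distr_eq) auto
  have "(\<integral>x. x i ^ k \<partial>gauss m s) = (\<integral>x. x ^ k \<partial>distr (gauss m s) borel (\<lambda>x. x i))"
    by (subst integral_distr) auto
  also have "\<dots> = (\<integral>x. normal_density 0 s x * x ^ k \<partial>lborel)"
    unfolding distr_gauss_component[OF assms] by (subst integral_density) auto
  finally show "(\<integral>x. x i ^ k \<partial>gauss m s) = (\<integral>x. normal_density 0 s x * x ^ k \<partial>lborel)" .
qed

lemma gauss_component_moments:
  assumes "s > 0" "i < m"
  shows "integrable (gauss m s) (\<lambda>x. x i)" "integrable (gauss m s) (\<lambda>x. (x i)\<^sup>2)"
    and "(\<integral>x. x i \<partial>gauss m s) = 0" "(\<integral>x. (x i)\<^sup>2 \<partial>gauss m s) = s\<^sup>2"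
  using gauss_component_power[OF assms, of 1] gauss_component_power[OF assms, of 2]
    integral_normal_moment_nz_1[OF assms(1), of 0]
    integral_normal_moment_even[OF assms(1), of 0 1] 
  by (simp_all add: power2_eq_square)

section \<open>Marginals and sections of product measures\<close>

lemma (in prob_space) distr_pair_snd:
  assumes "sigma_finite_measure N"
  shows "distr (M \<Otimes>\<^sub>M N) N snd = N"
proof (rule measure_eqI)
  interpret N: sigma_finite_measure N by fact
  fix A assume "A \<in> sets (distr (M \<Otimes>\<^sub>M N) N snd)"
  then have A: "A \<in> sets N" by simp
  then have "snd -` A \<inter> space (M \<Otimes>\<^sub>M N) = space M \<times> A"
    using sets.sets_into_space by (auto simp: space_pair_measure)
  with A show "emeasure (distr (M \<Otimes>\<^sub>M N) N snd) A = emeasure N A"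
    by (simp add: emeasure_distr N.emeasure_pair_measure_Times emeasure_space_1)
qed simp

text \<open>The Bochner integral of a non-integrable function is 0 by convention, so vanishing
  sections suffice without any integrability hypothesis.\<close>

lemma (in pair_sigma_finite) integral_eq_0_if_sections_0:
  fixes f :: "_ \<Rightarrow> real"
  assumes "\<And>x. x \<in> space M1 \<Longrightarrow> (\<integral>y. f (x, y) \<partial>M2) = 0"
  shows "integral\<^sup>L (M1 \<Otimes>\<^sub>M M2) f = 0"
proof (cases "integrable (M1 \<Otimes>\<^sub>M M2) f")
  case True
  then have "integral\<^sup>L (M1 \<Otimes>\<^sub>M M2) f = (\<integral>x. (\<integral>y. f (x, y) \<partial>M2) \<partial>M1)"
    by (rule integral_fst'[symmetric])
  also have "\<dots> = (\<integral>x. 0 \<partial>M1)"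
    by (rule Bochner_Integration.integral_cong) (use assms in auto)
  finally show ?thesis by simp
qed (rule not_integrable_integral_eq)

section \<open>Inner products and scaling of vectors\<close>

definition vinner :: "nat \<Rightarrow> (nat \<Rightarrow> real) \<Rightarrow> (nat \<Rightarrow> real) \<Rightarrow> real" where
  "vinner m x y = (\<Sum>i<m. x i * y i)"

lemma measurable_vinner [measurable]:
  assumes [measurable]: "f \<in> N \<rightarrow>\<^sub>M Rm m" "g \<in> N \<rightarrow>\<^sub>M Rm m"
  shows "(\<lambda>w. vinner m (f w) (g w)) \<in> borel_measurable N"
  unfolding vinner_def
  using measurable_component_comp_Rm[OF assms(1)] measurable_component_comp_Rm[OF assms(2)]
  by (intro borel_measurable_sum borel_measurable_times) auto

text \<open>The missing factor 1/2 is immaterial: the bound serves to dominate a mixed product by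
  integrable squares.\<close>

lemma abs_vinner_le: "\<bar>vinner m x y\<bar> \<le> vinner m x x + vinner m y y"
proof -
  have "\<bar>x i * y i\<bar> \<le> x i * x i + y i * y i" for i
  proof -
    have "2 * \<bar>x i * y i\<bar> \<le> x i * x i + y i * y i"
      using sum_squares_bound[of "\<bar>x i\<bar>" "\<bar>y i\<bar>"] by (simp add: abs_mult power2_eq_square)
    then show ?thesis by linarith
  qed
  then have "(\<Sum>i<m. \<bar>x i * y i\<bar>) \<le> (\<Sum>i<m. x i * x i + y i * y i)"
    by (intro sum_mono)
  from order_trans[OF sum_abs this] show ?thesis
    by (simp add: vinner_def sum.distrib)
qed

lemma vinner_self_nonneg: "vinner m x x \<ge> 0"
  by (simp add: vinner_def sum_nonneg)

lemma integrable_vinner: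
  assumes [measurable]: "f \<in> N \<rightarrow>\<^sub>M Rm m" "g \<in> N \<rightarrow>\<^sub>M Rm m"
    and "integrable N (\<lambda>w. vinner m (f w) (f w))" "integrable N (\<lambda>w. vinner m (g w) (g w))"
  shows "integrable N (\<lambda>w. vinner m (f w) (g w))"
  by (rule Bochner_Integration.integrable_bound[OF Bochner_Integration.integrable_add[OF assms(3,4)]])
     (auto simp: vinner_self_nonneg abs_vinner_le)

lemma sqdist_eq_vinner: "sqdist m x y = vinner m x x - 2 * vinner m x y + vinner m y y"
proof -
  have "(x i - y i)\<^sup>2 = x i * x i - 2 * (x i * y i) + y i * y i" for i
    by (simp add: power2_eq_square algebra_simps)
  then show ?thesis
    by (simp add: sqdist_def vinner_def sum.distrib sum_subtractf sum_distrib_left)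
qed

lemma sqdist_nonneg [simp]: "sqdist m x y \<ge> 0"
  by (simp add: sqdist_def sum_nonneg)

lemma sqdist_zero_vec: "sqdist m x (zero_vec m) = vinner m x x"
  by (simp add: sqdist_def vinner_def zero_vec_def power2_eq_square)

lemma vinner_vadd_right: "vinner m x (vadd m y z) = vinner m x y + vinner m x z"
  by (simp add: vinner_def vadd_def distrib_left sum.distrib)

lemma vinner_vadd_left: "vinner m (vadd m y z) x = vinner m y x + vinner m z x"
  by (simp add: vinner_def vadd_def distrib_right sum.distrib)

lemma vinner_commute: "vinner m x y = vinner m y x"
  by (simp add: vinner_def mult.commute)

definition vscale :: "nat \<Rightarrow> real \<Rightarrow> (nat \<Rightarrow> real) \<Rightarrow> (nat \<Rightarrow> real)" where
  "vscale m a x = (\<lambda>i\<in>{..<m}. a * x i)"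

lemma measurable_vscale [measurable]:
  assumes "f \<in> N \<rightarrow>\<^sub>M Rm m"
  shows "(\<lambda>w. vscale m a (f w)) \<in> N \<rightarrow>\<^sub>M Rm m"
  unfolding vscale_def Rm_def
  by (rule measurable_restrict) (use measurable_component_comp_Rm[OF assms] in auto)

lemma vinner_vscale_right: "vinner m x (vscale m a y) = a * vinner m x y"
  by (simp add: vinner_def vscale_def sum_distrib_left algebra_simps)

lemma vinner_vscale_left: "vinner m (vscale m a y) x = a * vinner m y x"
  by (simp add: vinner_def vscale_def sum_distrib_left algebra_simps)

lemma vinner_gauss:
  assumes "s > 0"
  shows "integrable (gauss m s) (\<lambda>x. vinner m x x)"
    and "(\<integral>x. vinner m x x \<partial>gauss m s) = real m * s\<^sup>2"
    and "(\<integral>x. vinner m a x \<partial>gauss m s) = 0"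
  using gauss_component_moments[OF assms]
  unfolding vinner_def power2_eq_square[symmetric]
  by (auto intro!: sum.neutral)

section \<open>The probability space of a code\<close>

text \<open>One code at a fixed blocklength; limits are taken outside. Blocklength 0 is excluded
  because \<open>reliable_codes\<close> does not constrain it and averages divide by
  \<open>m\<close>.\<close>

locale gaussian_code =
  fixes \<sigma> P R :: real and m :: nat and enc :: encoder and dec :: decoder
  assumes \<sigma>_pos: "\<sigma> > 0" and R_nonneg: "R \<ge> 0" and P_nonneg: "P \<ge> 0" and m_pos: "m \<ge> 1"
    and is_enc: "is_encoder R m enc" and is_dec: "is_decoder R m dec"
    and power: "power_constraint \<sigma> P R m enc"
begin

abbreviation "J \<equiv> joint \<sigma> R m"
abbreviation "K \<equiv> real (card (messages R m))"
abbreviation "x0 \<omega> \<equiv> fst (snd \<omega> :: (nat \<Rightarrow> real) \<times> (nat \<Rightarrow> real))"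
abbreviation "z \<omega> \<equiv> snd (snd \<omega> :: (nat \<Rightarrow> real) \<times> (nat \<Rightarrow> real))"
abbreviation "x1 \<equiv> X1 enc"
abbreviation "y \<equiv> Y m enc"
abbreviation "xhat v \<equiv> fst (dec v)"
abbreviation "mhat v \<equiv> snd (dec v)"
abbreviation "err \<equiv> error_prob \<sigma> R m enc dec"

lemma finite_messages: "finite (messages R m)"
  by (simp add: messages_def)

lemma one_in_messages: "1 \<in> messages R m"
  using R_nonneg by (simp add: messages_def le_nat_iff le_floor_iff ge_one_powr_ge_zero)

lemma K_ge_1: "K \<ge> 1"
  using one_in_messages finite_messages card_0_eq by (auto simp: Suc_le_eq card_gt_0_iff)

lemma prob_space_U: "prob_space (uniform_count_measure (messages R m))"
  using one_in_messages finite_messages by (intro prob_space_uniform_count_measure) auto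

sublocale U: prob_space "uniform_count_measure (messages R m)"
  by (rule prob_space_U)

sublocale G: prob_space "gauss m \<sigma>"
  by (rule prob_space_gauss[OF \<sigma>_pos])

sublocale N: prob_space "gauss m 1"
  by (rule prob_space_gauss) simp

sublocale GN: pair_prob_space "gauss m \<sigma>" "gauss m 1" ..

sublocale UGN: pair_prob_space "uniform_count_measure (messages R m)" "gauss m \<sigma> \<Otimes>\<^sub>M gauss m 1" ..

lemma prob_space_J: "prob_space J"
  unfolding joint_def by (rule UGN.prob_space_axioms)

sublocale J: prob_space J
  by (rule prob_space_J)

lemma measurable_x0 [measurable]: "x0 \<in> J \<rightarrow>\<^sub>M Rm m"
  and measurable_z [measurable]: "z \<in> J \<rightarrow>\<^sub>M Rm m"
  and measurable_msg [measurable]: "fst \<in> J \<rightarrow>\<^sub>M count_space (messages R m)"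
  unfolding joint_def by measurable

lemma measurable_enc [measurable]: "enc \<in> count_space (messages R m) \<Otimes>\<^sub>M Rm m \<rightarrow>\<^sub>M Rm m"
  using is_enc by (simp add: is_encoder_def)

lemma measurable_dec [measurable]: "dec \<in> Rm m \<rightarrow>\<^sub>M Rm m \<Otimes>\<^sub>M count_space (messages R m)"
  using is_dec by (simp add: is_decoder_def)

lemma x1_eq: "x1 = (\<lambda>\<omega>. enc (fst \<omega>, x0 \<omega>))"
  by (auto simp: X1_def)

lemma y_eq: "y = (\<lambda>\<omega>. vadd m (x1 \<omega>) (z \<omega>))"
  by (auto simp: Y_def)

lemma measurable_x1 [measurable]: "x1 \<in> J \<rightarrow>\<^sub>M Rm m"
  unfolding x1_eq by measurable

lemma measurable_y [measurable]: "y \<in> J \<rightarrow>\<^sub>M Rm m"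
  unfolding y_eq by measurable

text \<open>The noise is integrated innermost, so that for a fixed message and host the channel
  input is a constant shift of it.\<close>

lemma nn_integral_J:
  assumes [measurable]: "f \<in> borel_measurable J"
  shows "(\<integral>\<^sup>+\<omega>. f \<omega> \<partial>J)
    = (\<Sum>k\<in>messages R m. ennreal (1 / K) * (\<integral>\<^sup>+x. \<integral>\<^sup>+v. f (k, x, v) \<partial>gauss m 1 \<partial>gauss m \<sigma>))"
proof -
  have f: "f \<in> borel_measurable (uniform_count_measure (messages R m) \<Otimes>\<^sub>M (gauss m \<sigma> \<Otimes>\<^sub>M gauss m 1))"
    using assms unfolding joint_def .
  have "(\<integral>\<^sup>+\<omega>. f \<omega> \<partial>J)
    = (\<integral>\<^sup>+k. \<integral>\<^sup>+\<xi>. f (k, \<xi>) \<partial>(gauss m \<sigma> \<Otimes>\<^sub>M gauss m 1) \<partial>uniform_count_measure (messages R m))"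
    unfolding joint_def by (rule GN.nn_integral_fst[OF f, symmetric])
  also have "\<dots> = (\<Sum>k\<in>messages R m. ennreal (1 / K) * (\<integral>\<^sup>+\<xi>. f (k, \<xi>) \<partial>(gauss m \<sigma> \<Otimes>\<^sub>M gauss m 1)))"
    unfolding uniform_count_measure_def
    by (rule nn_integral_point_measure_finite[OF finite_messages])
  also have "\<dots> = (\<Sum>k\<in>messages R m. ennreal (1 / K) * (\<integral>\<^sup>+x. \<integral>\<^sup>+v. f (k, x, v) \<partial>gauss m 1 \<partial>gauss m \<sigma>))"
  proof (intro sum.cong refl arg_cong2[where f="(*)"])
    fix k assume "k \<in> messages R m"
    then have "(\<lambda>\<xi>. f (k, \<xi>)) \<in> borel_measurable (gauss m \<sigma> \<Otimes>\<^sub>M gauss m 1)"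
      using f by (intro measurable_compose[OF measurable_Pair1' f]) (simp add: space_uniform_count_measure)
    then show "(\<integral>\<^sup>+\<xi>. f (k, \<xi>) \<partial>(gauss m \<sigma> \<Otimes>\<^sub>M gauss m 1))
      = (\<integral>\<^sup>+x. \<integral>\<^sup>+v. f (k, x, v) \<partial>gauss m 1 \<partial>gauss m \<sigma>)"
      by (rule N.nn_integral_fst[symmetric])
  qed
  finally show ?thesis .
qed

section \<open>Marginals and second moments of host, noise and channel input\<close>

lemma measurable_snd_J: "snd \<in> J \<rightarrow>\<^sub>M gauss m \<sigma> \<Otimes>\<^sub>M gauss m 1"
  unfolding joint_def by (rule measurable_snd)

lemma distr_snd_J: "distr J (gauss m \<sigma> \<Otimes>\<^sub>M gauss m 1) snd = gauss m \<sigma> \<Otimes>\<^sub>M gauss m 1"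
  unfolding joint_def by (rule U.distr_pair_snd) unfold_locales

lemma distr_x0: "distr J (gauss m \<sigma>) x0 = gauss m \<sigma>"
proof -
  have "distr J (gauss m \<sigma>) x0 = distr (distr J (gauss m \<sigma> \<Otimes>\<^sub>M gauss m 1) snd) (gauss m \<sigma>) fst"
    unfolding distr_distr[OF measurable_fst measurable_snd_J] comp_def ..
  also have "\<dots> = gauss m \<sigma>"
    unfolding distr_snd_J by (rule N.distr_pair_fst)
  finally show ?thesis .
qed

lemma distr_z: "distr J (gauss m 1) z = gauss m 1"
proof -
  have "distr J (gauss m 1) z = distr (distr J (gauss m \<sigma> \<Otimes>\<^sub>M gauss m 1) snd) (gauss m 1) snd"
    unfolding distr_distr[OF measurable_snd measurable_snd_J] comp_def ..
  also have "\<dots> = gauss m 1"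
    unfolding distr_snd_J by (rule G.distr_pair_snd) unfold_locales
  finally show ?thesis .
qed

lemma vinner_x0: "integrable J (\<lambda>\<omega>. vinner m (x0 \<omega>) (x0 \<omega>))"
    "(\<integral>\<omega>. vinner m (x0 \<omega>) (x0 \<omega>) \<partial>J) = real m * \<sigma>\<^sup>2"
  and vinner_z: "integrable J (\<lambda>\<omega>. vinner m (z \<omega>) (z \<omega>))"
    "(\<integral>\<omega>. vinner m (z \<omega>) (z \<omega>) \<partial>J) = real m"
proof -
  have x: "x0 \<in> J \<rightarrow>\<^sub>M gauss m \<sigma>" and v: "z \<in> J \<rightarrow>\<^sub>M gauss m 1"
    unfolding joint_def by measurable
  have b: "(\<lambda>x. vinner m x x) \<in> borel_measurable (gauss m s)" for s
    by measurable
  show "integrable J (\<lambda>\<omega>. vinner m (x0 \<omega>) (x0 \<omega>))"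
    using integrable_distr_eq[OF x b] vinner_gauss(1)[OF \<sigma>_pos] by (simp add: distr_x0)
  show "(\<integral>\<omega>. vinner m (x0 \<omega>) (x0 \<omega>) \<partial>J) = real m * \<sigma>\<^sup>2"
    using integral_distr[OF x b] vinner_gauss(2)[OF \<sigma>_pos] by (simp add: distr_x0)
  show "integrable J (\<lambda>\<omega>. vinner m (z \<omega>) (z \<omega>))"
    using integrable_distr_eq[OF v b] vinner_gauss(1)[of 1] by (simp add: distr_z)
  show "(\<integral>\<omega>. vinner m (z \<omega>) (z \<omega>) \<partial>J) = real m"
    using integral_distr[OF v b] vinner_gauss(2)[of 1] by (simp add: distr_z)
qed

text \<open>Host and channel input are functions of message and host alone, so for fixed values of
  these the integral over the centred noise vanishes.\<close>

lemma vinner_x0_z: "(\<integral>\<omega>. vinner m (x0 \<omega>) (z \<omega>) \<partial>J) = 0"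
  and vinner_x1_z: "(\<integral>\<omega>. vinner m (x1 \<omega>) (z \<omega>) \<partial>J) = 0"
  unfolding joint_def
  by (rule UGN.integral_eq_0_if_sections_0, rule GN.integral_eq_0_if_sections_0,
      simp add: x1_eq vinner_gauss(3))+

text \<open>Averaging the constraint of each message over the uniform message preserves it. The
  computation is done with the nonnegative integral, whose finiteness then yields
  integrability.\<close>

lemma sqdist_x0_x1: "integrable J (\<lambda>\<omega>. sqdist m (x0 \<omega>) (x1 \<omega>))"
    "(\<integral>\<omega>. sqdist m (x0 \<omega>) (x1 \<omega>) \<partial>J) \<le> real m * P"
proof -
  have "(\<integral>\<^sup>+\<omega>. ennreal (sqdist m (x0 \<omega>) (x1 \<omega>)) \<partial>J)
    = (\<Sum>k\<in>messages R m. ennreal (1 / K) * (\<integral>\<^sup>+x. ennreal (sqdist m x (enc (k, x))) \<partial>gauss m \<sigma>))"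
    by (subst nn_integral_J) (auto simp: x1_eq N.emeasure_space_1)
  also have "\<dots> \<le> (\<Sum>k\<in>messages R m. ennreal (1 / K) * ennreal (real m * P))"
    using power unfolding power_constraint_def by (intro sum_mono mult_left_mono) auto
  also have "\<dots> = ennreal (real m * P)"
    using K_ge_1 P_nonneg by (simp add: ennreal_of_nat_eq_real_of_nat ennreal_mult'[symmetric])
  finally have *: "(\<integral>\<^sup>+\<omega>. ennreal (sqdist m (x0 \<omega>) (x1 \<omega>)) \<partial>J) \<le> ennreal (real m * P)" .
  show int: "integrable J (\<lambda>\<omega>. sqdist m (x0 \<omega>) (x1 \<omega>))"
    by (rule integrableI_bounded) (use * in \<open>auto intro: le_less_trans\<close>)
  from * show "(\<integral>\<omega>. sqdist m (x0 \<omega>) (x1 \<omega>) \<partial>J) \<le> real m * P"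
    using P_nonneg by (subst (asm) nn_integral_eq_integral[OF int]) auto
qed

lemma integrable_vinner_x1: "integrable J (\<lambda>\<omega>. vinner m (x1 \<omega>) (x1 \<omega>))"
proof (rule Bochner_Integration.integrable_bound)
  show "integrable J (\<lambda>\<omega>. 2 * vinner m (x0 \<omega>) (x0 \<omega>) + 2 * sqdist m (x0 \<omega>) (x1 \<omega>))"
    using vinner_x0(1) sqdist_x0_x1(1) by auto
  have "vinner m b b \<le> 2 * vinner m a a + 2 * sqdist m a b" for a b
  proof -
    have "b i * b i \<le> 2 * (a i * a i) + 2 * (a i - b i)\<^sup>2" for i
    proof -
      \<comment> \<open>This square is exactly the difference of the two sides.\<close>
      have "0 \<le> (2 * a i - b i)\<^sup>2" by simp
      then show ?thesis by (simp add: power2_eq_square algebra_simps)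
    qed
    then have "vinner m b b \<le> (\<Sum>i<m. 2 * (a i * a i) + 2 * (a i - b i)\<^sup>2)"
      unfolding vinner_def by (intro sum_mono)
    then show ?thesis by (simp add: vinner_def sqdist_def sum.distrib sum_distrib_left)
  qed
  then show "AE \<omega> in J. norm (vinner m (x1 \<omega>) (x1 \<omega>))
      \<le> norm (2 * vinner m (x0 \<omega>) (x0 \<omega>) + 2 * sqdist m (x0 \<omega>) (x1 \<omega>))"
    by (simp add: vinner_self_nonneg)
qed measurable

section \<open>Change of measure\<close>

text \<open>The uniform part keeps the logarithm above \<open>- ln (2 K)\<close> where the decoder errs.\<close>

definition msg_weight :: "nat \<Rightarrow> (nat \<Rightarrow> real) \<Rightarrow> real" where
  "msg_weight k v = (if k = mhat v then 1/2 else 0) + 1 / (2 * K)"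

lemma msg_weight_ge: "msg_weight k v \<ge> 1 / (2 * K)" "msg_weight (mhat v) v \<ge> 1 / 2"
  using K_ge_1 by (auto simp: msg_weight_def)

lemma msg_weight_pos: "msg_weight k v > 0"
  using msg_weight_ge(1)[of k v] K_ge_1 by (smt (verit) divide_pos_pos)

lemma sum_msg_weight:
  assumes "v \<in> space (Rm m)"
  shows "(\<Sum>k\<in>messages R m. msg_weight k v) = 1"
proof -
  have "mhat v \<in> messages R m"
    using measurable_space[OF measurable_dec assms] by (auto simp: space_pair_measure)
  then show ?thesis
    using finite_messages K_ge_1 by (auto simp: msg_weight_def sum.distrib)
qed

lemma measurable_msg_weight [measurable]:
  assumes "k \<in> messages R m"
  shows "msg_weight k \<in> borel_measurable (Rm m)"
proof -
  have "mhat \<in> Rm m \<rightarrow>\<^sub>M count_space (messages R m)" by measurable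
  then have "Measurable.pred (Rm m) (\<lambda>v. k = mhat v)" by measurable
  then show ?thesis unfolding msg_weight_def[abs_def] by measurable
qed

lemma measurable_correct [measurable]: "Measurable.pred J (\<lambda>\<omega>. fst \<omega> = mhat (y \<omega>))"
proof -
  \<comment> \<open>The two messages are viewed as values in \<open>borel\<close>, where the set on
    which two measurable functions agree is measurable.\<close>
  have id: "(\<lambda>k. k) \<in> count_space (messages R m) \<rightarrow>\<^sub>M (borel :: nat measure)"
    by simp
  have "(\<lambda>\<omega>. mhat (y \<omega>)) \<in> J \<rightarrow>\<^sub>M count_space (messages R m)"
    by measurable
  from measurable_compose[OF this id] measurable_compose[OF measurable_msg id]
  show ?thesis
    unfolding pred_def by (intro measurable_equality_set)
qed

lemma measurable_msg_weight_J [measurable]: "(\<lambda>\<omega>. msg_weight (fst \<omega>) (y \<omega>)) \<in> borel_measurable J"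
  unfolding msg_weight_def by measurable

text \<open>The integrand is the likelihood ratio g/f, with the output written as input plus noise
  and the uniform message probability giving the factor \<open>K\<close>. Integrating it against f
  leaves the total mass of g, which is 1: first over the host, then over the messages, then over the
  output. The first integration works because the centre \<open>u\<close> depends on the output
  only.\<close>

lemma change_of_measure:
  assumes S: "S > 0" and D: "D > 0" and u [measurable]: "u \<in> Rm m \<rightarrow>\<^sub>M Rm m"
  shows "(\<integral>\<^sup>+\<omega>. ennreal (K * msg_weight (fst \<omega>) (y \<omega>) * gauss_density m (zero_vec m) S (y \<omega>)
      * gauss_density m (u (y \<omega>)) D (x0 \<omega>)
      / (gauss_density m (zero_vec m) (\<sigma>\<^sup>2) (x0 \<omega>) * gauss_density m (zero_vec m) 1 (z \<omega>))) \<partial>J) = 1"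
    (is "(\<integral>\<^sup>+\<omega>. ennreal (?G \<omega>) \<partial>J) = 1")
proof -
  let ?g = "gauss_density m (zero_vec m)"
  \<comment> \<open>The comparison density g in the coordinates message, host, output.\<close>
  define H where "H k x w = msg_weight k w * ?g S w * gauss_density m (u w) D x" for k x w
  let ?L = "lebesgue_vec m"
  interpret L: sigma_finite_measure ?L by (rule sigma_finite_lebesgue_vec)
  interpret LL: pair_sigma_finite ?L ?L ..
  have pos: "?g v x > 0" if "v > 0" for v x using that by (rule gauss_density_pos)
  have \<sigma>2: "\<sigma>\<^sup>2 > 0" using \<sigma>_pos by simp
  have H_nonneg: "H k x w \<ge> 0" for k x w
    unfolding H_def using msg_weight_pos[of k w] pos[OF S] gauss_density_pos[OF D]
    by (intro mult_nonneg_nonneg less_imp_le)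
  have mH [measurable]: "(\<lambda>p. H k (f p) (g p)) \<in> borel_measurable Q"
    if "k \<in> messages R m" "f \<in> Q \<rightarrow>\<^sub>M Rm m" "g \<in> Q \<rightarrow>\<^sub>M Rm m"
    for k f g and Q :: "'q measure"
    using that(2,3) measurable_compose[OF that(3) measurable_msg_weight[OF that(1)]] unfolding H_def by measurable
  \<comment> \<open>For a fixed message the true densities of host and noise cancel the
    denominators, and translating by the codeword replaces the noise by the output.\<close>
  have sec: "(\<integral>\<^sup>+x. \<integral>\<^sup>+v. ennreal (?G (k, x, v)) \<partial>gauss m 1 \<partial>gauss m \<sigma>)
      = (\<integral>\<^sup>+x. \<integral>\<^sup>+w. ennreal (K * H k x w) \<partial>?L \<partial>?L)" if k: "k \<in> messages R m" for k
  proof -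
    note mH' = mH[OF k]
    have [measurable]: "(\<lambda>x. enc (k, x)) \<in> Rm m \<rightarrow>\<^sub>M Rm m"
      using k by (intro measurable_compose[OF measurable_Pair1' measurable_enc]) simp
    have in1: "(\<integral>\<^sup>+v. ennreal (?G (k, x, v)) \<partial>gauss m 1)
        = (\<integral>\<^sup>+w. ennreal (K * H k x w / ?g (\<sigma>\<^sup>2) x) \<partial>?L)" if x: "x \<in> space (Rm m)" for x
    proof -
      have [measurable]: "enc (k, x) \<in> space (Rm m)"
        using measurable_space[OF measurable_enc] k x by (simp add: space_pair_measure)
      have G: "?G (k, x, v) = K * H k x (vadd m (enc (k, x)) v) / ?g (\<sigma>\<^sup>2) x / ?g 1 v" for v
        by (simp add: H_def Y_def X1_def)
      have [measurable]: "(\<lambda>w. H k x w) \<in> borel_measurable (Rm m)"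
        using x by (intro mH') auto
      have "(\<integral>\<^sup>+v. ennreal (?G (k, x, v)) \<partial>gauss m 1)
        = (\<integral>\<^sup>+v. ennreal (?g 1 v) * ennreal (K * H k x (vadd m (enc (k, x)) v) / ?g (\<sigma>\<^sup>2) x / ?g 1 v) \<partial>?L)"
        unfolding G gauss_eq_density[OF zero_less_one] by (subst nn_integral_density) auto
      also have "\<dots> = (\<integral>\<^sup>+v. ennreal (K * H k x (vadd m (enc (k, x)) v) / ?g (\<sigma>\<^sup>2) x) \<partial>?L)"
        using pos[of 1] pos[OF \<sigma>2] H_nonneg 
        by (intro nn_integral_cong) (simp add: ennreal_mult'[symmetric] less_imp_le less_imp_neq[THEN not_sym])
      also have "\<dots> = (\<integral>\<^sup>+w. ennreal (K * H k x w / ?g (\<sigma>\<^sup>2) x) \<partial>?L)"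
        by (rule nn_integral_lebesgue_vec_vadd) measurable
      finally show ?thesis .
    qed
    have "(\<integral>\<^sup>+x. \<integral>\<^sup>+v. ennreal (?G (k, x, v)) \<partial>gauss m 1 \<partial>gauss m \<sigma>)
      = (\<integral>\<^sup>+x. \<integral>\<^sup>+w. ennreal (K * H k x w / ?g (\<sigma>\<^sup>2) x) \<partial>?L \<partial>gauss m \<sigma>)"
      using sets_eq_imp_space_eq[OF sets_gauss] by (intro nn_integral_cong in1) auto
    also have "\<dots> = (\<integral>\<^sup>+x. ennreal (?g (\<sigma>\<^sup>2) x) * (\<integral>\<^sup>+w. ennreal (K * H k x w / ?g (\<sigma>\<^sup>2) x) \<partial>?L) \<partial>?L)"
      unfolding gauss_eq_density[OF \<sigma>_pos]
    proof (rule nn_integral_density)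
      have "(\<lambda>(x, w). ennreal (K * H k x w / ?g (\<sigma>\<^sup>2) x)) \<in> borel_measurable (?L \<Otimes>\<^sub>M ?L)"
        unfolding case_prod_unfold
        using mH'[OF measurable_fst measurable_snd, unfolded measurable_cong_sets[OF sets_pair_measure_cong[OF sets_Rm_lebesgue_vec sets_Rm_lebesgue_vec, symmetric] refl]]
        by measurable
      then show "(\<lambda>x. \<integral>\<^sup>+w. ennreal (K * H k x w / ?g (\<sigma>\<^sup>2) x) \<partial>?L) \<in> borel_measurable ?L"
        by (rule L.borel_measurable_nn_integral)
    qed measurable
    also have "\<dots> = (\<integral>\<^sup>+x. \<integral>\<^sup>+w. ennreal (K * H k x w) \<partial>?L \<partial>?L)"
    proof (rule nn_integral_cong)
      fix x assume "x \<in> space ?L"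
      then have "x \<in> space (Rm m)" by (simp add: sets_eq_imp_space_eq[OF sets_Rm_lebesgue_vec])
      then have [measurable]: "(\<lambda>w. H k x w) \<in> borel_measurable ?L"
        by (intro mH') auto
      show "ennreal (?g (\<sigma>\<^sup>2) x) * (\<integral>\<^sup>+w. ennreal (K * H k x w / ?g (\<sigma>\<^sup>2) x) \<partial>?L)
        = (\<integral>\<^sup>+w. ennreal (K * H k x w) \<partial>?L)"
        using pos[OF \<sigma>2, of x] H_nonneg 
        by (subst nn_integral_cmult[symmetric])
          (auto simp: ennreal_mult'[symmetric] intro!: nn_integral_cong)
    qed
    finally show ?thesis .
  qed
  have mHL: "(\<lambda>p. ennreal (H k (fst p) (snd p))) \<in> borel_measurable (?L \<Otimes>\<^sub>M ?L)"
    if "k \<in> messages R m" for k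
    using mH[OF that measurable_fst measurable_snd, unfolded measurable_cong_sets[OF sets_pair_measure_cong[OF sets_Rm_lebesgue_vec sets_Rm_lebesgue_vec, symmetric] refl]]
    by measurable
  have "(\<integral>\<^sup>+\<omega>. ennreal (?G \<omega>) \<partial>J)
    = (\<Sum>k\<in>messages R m. ennreal (1 / K) * (\<integral>\<^sup>+x. \<integral>\<^sup>+v. ennreal (?G (k, x, v)) \<partial>gauss m 1 \<partial>gauss m \<sigma>))"
    by (rule nn_integral_J) measurable
  also have "\<dots> = (\<Sum>k\<in>messages R m. ennreal (1 / K) * (\<integral>\<^sup>+x. \<integral>\<^sup>+w. ennreal (K * H k x w) \<partial>?L \<partial>?L))"
    by (rule sum.cong[OF refl]) (simp only: sec)
  also have "\<dots> = (\<Sum>k\<in>messages R m. \<integral>\<^sup>+w. \<integral>\<^sup>+x. ennreal (H k x w) \<partial>?L \<partial>?L)"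
  proof (rule sum.cong[OF refl])
    fix k assume k: "k \<in> messages R m"
    note [measurable] = mHL[OF k]
    have s: "(\<integral>\<^sup>+x. \<integral>\<^sup>+w. f x w \<partial>?L \<partial>?L) = (\<integral>\<^sup>+p. f (fst p) (snd p) \<partial>(?L \<Otimes>\<^sub>M ?L))"
      if "(\<lambda>p. f (fst p) (snd p)) \<in> borel_measurable (?L \<Otimes>\<^sub>M ?L)"
      for f :: "(nat \<Rightarrow> real) \<Rightarrow> (nat \<Rightarrow> real) \<Rightarrow> ennreal"
      using L.nn_integral_fst[OF that] by simp
    have KH: "ennreal (K * H k x w) = ennreal K * ennreal (H k x w)" for x w
      using H_nonneg by (simp add: ennreal_mult')
    have "ennreal (1 / K) * (\<integral>\<^sup>+x. \<integral>\<^sup>+w. ennreal (K * H k x w) \<partial>?L \<partial>?L)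
       = ennreal (1 / K) * (ennreal K * (\<integral>\<^sup>+x. \<integral>\<^sup>+w. ennreal (H k x w) \<partial>?L \<partial>?L))"
      unfolding KH
      by (subst (1 2) s) (simp_all add: nn_integral_cmult)
    also have "\<dots> = (\<integral>\<^sup>+x. \<integral>\<^sup>+w. ennreal (H k x w) \<partial>?L \<partial>?L)"
      using K_ge_1 unfolding mult.assoc[symmetric]
      by (subst ennreal_mult'[symmetric]) auto
    \<comment> \<open>The order is exchanged because the host density in g is conditional on the
      output.\<close>
    also have "\<dots> = (\<integral>\<^sup>+w. \<integral>\<^sup>+x. ennreal (H k x w) \<partial>?L \<partial>?L)"
      by (rule LL.Fubini'[symmetric]) (simp add: case_prod_unfold)
    finally show "ennreal (1 / K) * (\<integral>\<^sup>+x. \<integral>\<^sup>+w. ennreal (K * H k x w) \<partial>?L \<partial>?L)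
      = (\<integral>\<^sup>+w. \<integral>\<^sup>+x. ennreal (H k x w) \<partial>?L \<partial>?L)" .
  qed
  also have "\<dots> = (\<Sum>k\<in>messages R m. \<integral>\<^sup>+w. ennreal (msg_weight k w * ?g S w) \<partial>?L)"
  proof (intro sum.cong[OF refl] nn_integral_cong)
    fix k w assume "w \<in> space ?L"
    then have w: "w \<in> space (Rm m)" by (simp add: sets_eq_imp_space_eq[OF sets_Rm_lebesgue_vec])
    then have [measurable]: "u w \<in> space (Rm m)" by (rule measurable_space[OF u])
    have "(\<integral>\<^sup>+x. ennreal (H k x w) \<partial>?L)
      = (\<integral>\<^sup>+x. ennreal (msg_weight k w * ?g S w) * ennreal (gauss_density m (u w) D x) \<partial>?L)"
      unfolding H_def using gauss_density_pos[OF D] pos[OF S] msg_weight_pos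
      by (intro nn_integral_cong) (simp add: ennreal_mult less_imp_le)
    also have "\<dots> = ennreal (msg_weight k w * ?g S w)"
      by (subst nn_integral_cmult) (auto simp: nn_integral_gauss_density[OF D])
    finally show "(\<integral>\<^sup>+x. ennreal (H k x w) \<partial>?L) = ennreal (msg_weight k w * ?g S w)" .
  qed
  also have "\<dots> = (\<integral>\<^sup>+w. (\<Sum>k\<in>messages R m. ennreal (msg_weight k w * ?g S w)) \<partial>?L)"
    by (rule nn_integral_sum[symmetric]) measurable
  also have "\<dots> = (\<integral>\<^sup>+w. ennreal (?g S w) \<partial>?L)"
  proof (rule nn_integral_cong)
    fix w assume "w \<in> space ?L"
    then have w: "w \<in> space (Rm m)" by (simp add: sets_eq_imp_space_eq[OF sets_Rm_lebesgue_vec])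
    have "(\<Sum>k\<in>messages R m. ennreal (msg_weight k w * ?g S w)) = ennreal ((\<Sum>k\<in>messages R m. msg_weight k w) * ?g S w)"
      using msg_weight_pos pos[OF S] by (subst sum_ennreal) (auto simp: sum_distrib_right less_imp_le)
    then show "(\<Sum>k\<in>messages R m. ennreal (msg_weight k w * ?g S w)) = ennreal (?g S w)"
      by (simp add: sum_msg_weight[OF w])
  qed
  also have "\<dots> = 1"
    by (rule nn_integral_gauss_density[OF S])
  finally show ?thesis .
qed

text \<open>Instead of ln (g/f) itself, an explicit pointwise minorant \<open>L\<close> is
  integrated. It consists of second moments and one indicator, so it is visibly integrable, and ln t
  \<le> t - 1 bounds its expectation by E(g/f) - 1 = 0.\<close>

lemma converse_inequality:
  assumes S: "S > 0" and D: "D > 0" and u [measurable]: "u \<in> Rm m \<rightarrow>\<^sub>M Rm m"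
    and iS: "integrable J (\<lambda>\<omega>. vinner m (y \<omega>) (y \<omega>))"
    and leS: "(\<integral>\<omega>. vinner m (y \<omega>) (y \<omega>) \<partial>J) \<le> real m * S"
    and iD: "integrable J (\<lambda>\<omega>. sqdist m (x0 \<omega>) (u (y \<omega>)))"
    and leD: "(\<integral>\<omega>. sqdist m (x0 \<omega>) (u (y \<omega>)) \<partial>J) \<le> real m * D"
  shows "\<sigma>\<^sup>2 * exp (2 / real m * ((1 - err) * ln K - ln 2)) \<le> S * D"
proof -
  define G where "G \<omega> = K * msg_weight (fst \<omega>) (y \<omega>) * gauss_density m (zero_vec m) S (y \<omega>)
      * gauss_density m (u (y \<omega>)) D (x0 \<omega>)
      / (gauss_density m (zero_vec m) (\<sigma>\<^sup>2) (x0 \<omega>) * gauss_density m (zero_vec m) 1 (z \<omega>))" for \<omega>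
  define E where "E = {\<omega> \<in> space J. fst \<omega> \<noteq> mhat (y \<omega>)}"
  \<comment> \<open>The constant part of the logarithm: the 2 pi terms of the two Gaussians in the
    numerator cancel those of the two in the denominator, and - ln 2 comes from the weight 1/2 of
    the decoded message.\<close>
  define c where "c = ln K - ln 2 - real m / 2 * (ln S + ln D - ln (\<sigma>\<^sup>2))"
  define L where "L \<omega> = c - ln K * indicator E \<omega> - vinner m (y \<omega>) (y \<omega>) / (2 * S)
    - sqdist m (x0 \<omega>) (u (y \<omega>)) / (2 * D) + vinner m (x0 \<omega>) (x0 \<omega>) / (2 * \<sigma>\<^sup>2)
    + vinner m (z \<omega>) (z \<omega>) / 2" for \<omega>
  have \<sigma>2: "\<sigma>\<^sup>2 > 0" using \<sigma>_pos by simp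
  have K: "K > 0" using K_ge_1 by linarith
  note gp = gauss_density_pos
  have E [measurable]: "E \<in> sets J"
    unfolding E_def by measurable
  have iE: "integrable J (\<lambda>\<omega>. indicator E \<omega> :: real)"
    using E by (simp add: J.emeasure_eq_measure)
  have mE: "measure J E = err"
    by (simp add: error_prob_def E_def)
  have [measurable]: "G \<in> borel_measurable J"
    unfolding G_def by measurable
  have G_pos: "G \<omega> > 0" for \<omega>
    unfolding G_def using gp S D \<sigma>2 msg_weight_pos K by (intro divide_pos_pos mult_pos_pos) auto
  have intG: "integrable J G" and EG: "(\<integral>\<omega>. G \<omega> \<partial>J) = 1"
    using change_of_measure[OF S D u] G_pos
    by (auto simp: G_def[symmetric] less_imp_le intro!: integrableI_nn_integral_finite[where x=1] 
      integral_eq_nn_integral[THEN trans])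
  \<comment> \<open>On the error event only the uniform part 1/(2K) is available; elsewhere the
    weight is at least 1/2.\<close>
  have ln_msg_weight: "ln (msg_weight (fst \<omega>) (y \<omega>)) \<ge> - ln 2 - ln K * indicator E \<omega>" if "\<omega> \<in> space J" for \<omega>
  proof (cases "\<omega> \<in> E")
    case True
    have "ln (1 / (2 * K)) \<le> ln (msg_weight (fst \<omega>) (y \<omega>))"
      using msg_weight_ge(1) msg_weight_pos K by (subst ln_le_cancel_iff) auto
    then show ?thesis using True K by (simp add: ln_div ln_mult)
  next
    case False
    then have "fst \<omega> = mhat (y \<omega>)" using that by (simp add: E_def)
    then have "ln (1 / 2) \<le> ln (msg_weight (fst \<omega>) (y \<omega>))"
      using msg_weight_ge(2)[of "y \<omega>"] msg_weight_pos by (subst ln_le_cancel_iff) auto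
    then show ?thesis using False by (simp add: ln_div)
  qed
  have L_le: "L \<omega> \<le> G \<omega> - 1" if "\<omega> \<in> space J" for \<omega>
  proof -
    have "ln (G \<omega>) = ln K + ln (msg_weight (fst \<omega>) (y \<omega>)) + ln (gauss_density m (zero_vec m) S (y \<omega>))
       + ln (gauss_density m (u (y \<omega>)) D (x0 \<omega>)) - ln (gauss_density m (zero_vec m) (\<sigma>\<^sup>2) (x0 \<omega>))
       - ln (gauss_density m (zero_vec m) 1 (z \<omega>))"
      unfolding G_def using gp[OF S, of m] gp[OF D, of m] gp[OF \<sigma>2, of m] gp[of 1 m] msg_weight_pos[of "fst \<omega>" "y \<omega>"] K
      by (simp add: ln_div ln_mult less_imp_neq[THEN not_sym])
    also have "\<dots> \<ge> L \<omega>"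
      using ln_msg_weight[OF that] S D \<sigma>2
      by (simp add: ln_gauss_density sqdist_zero_vec L_def c_def ln_mult algebra_simps add_divide_distrib)
    finally have "L \<omega> \<le> ln (G \<omega>)" .
    with ln_le_minus_one[OF G_pos, of \<omega>] show ?thesis by linarith
  qed
  have intL: "integrable J L"
    unfolding L_def using iS iD vinner_x0(1) vinner_z(1) iE
    by (intro Bochner_Integration.integrable_add Bochner_Integration.integrable_diff
        integrable_divide_zero integrable_mult_right) auto
  have "(\<integral>\<omega>. L \<omega> \<partial>J) \<le> (\<integral>\<omega>. G \<omega> - 1 \<partial>J)"
    by (rule integral_mono) (use intL intG L_le in auto)
  also have "\<dots> = 0"
    using intG EG by (simp add: J.prob_space)
  finally have "(\<integral>\<omega>. L \<omega> \<partial>J) \<le> 0" .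
  moreover have "(\<integral>\<omega>. L \<omega> \<partial>J) = c - ln K * err - (\<integral>\<omega>. vinner m (y \<omega>) (y \<omega>) \<partial>J) / (2 * S)
    - (\<integral>\<omega>. sqdist m (x0 \<omega>) (u (y \<omega>)) \<partial>J) / (2 * D) + real m * \<sigma>\<^sup>2 / (2 * \<sigma>\<^sup>2) + real m / 2"
    unfolding L_def using iS iD vinner_x0 vinner_z E iE by (simp add: J.prob_space mE)
  moreover have "(\<integral>\<omega>. vinner m (y \<omega>) (y \<omega>) \<partial>J) / (2 * S) \<le> real m / 2"
    using leS S by (simp add: field_simps)
  moreover have "(\<integral>\<omega>. sqdist m (x0 \<omega>) (u (y \<omega>)) \<partial>J) / (2 * D) \<le> real m / 2"
    using leD D by (simp add: field_simps)
  moreover have "real m * \<sigma>\<^sup>2 / (2 * \<sigma>\<^sup>2) = real m / 2"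
    using \<sigma>2 by simp
  \<comment> \<open>Host and noise contribute m/2 each, while output and estimation error subtract
    at most m/2 each, so the quadratic terms drop out.\<close>
  ultimately have "c - ln K * err \<le> 0" by linarith
  then have "2 / real m * ((1 - err) * ln K - ln 2) + ln (\<sigma>\<^sup>2) \<le> ln S + ln D"
    using m_pos by (simp add: c_def field_simps)
  also have "\<dots> = ln (S * D)" using S D by (simp add: ln_mult)
  finally have "exp (2 / real m * ((1 - err) * ln K - ln 2) + ln (\<sigma>\<^sup>2)) \<le> exp (ln (S * D))"
    by simp
  then show ?thesis
    using S D \<sigma>2 by (simp add: exp_add mult.commute)
qed

end

section \<open>Single-letter bounds\<close>

text \<open>Young's inequality with a free weight. For positive a and b the choice t = b/a makes the
  right-hand side equal to (a + b)^2; choosing \<open>t\<close> after integration thus gives the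
  triangle inequality in L^2.\<close>

lemma square_add_le:
  fixes a b t :: real
  assumes "t > 0"
  shows "(a + b)\<^sup>2 \<le> (1 + t) * a\<^sup>2 + (1 + 1 / t) * b\<^sup>2"
proof -
  have "0 \<le> (t * a - b)\<^sup>2 / t" using assms by simp
  also have "\<dots> = t * a\<^sup>2 - 2 * a * b + b\<^sup>2 / t"
    using assms by (simp add: power2_eq_square field_simps)
  finally show ?thesis by (simp add: power2_eq_square algebra_simps)
qed

lemma sqdist_vscale_triangle:
  assumes "t > 0"
  shows "sqdist m x (vscale m \<gamma> w)
    \<le> (1 + t) * sqdist m x (vscale m \<gamma> v) + (1 + 1 / t) * (\<gamma>\<^sup>2 * sqdist m v w)"
proof -
  have "(x i - \<gamma> * w i)\<^sup>2 \<le> (1 + t) * (x i - \<gamma> * v i)\<^sup>2 + (1 + 1 / t) * (\<gamma>\<^sup>2 * (v i - w i)\<^sup>2)" for i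
  proof -
    have "x i - \<gamma> * w i = (x i - \<gamma> * v i) + \<gamma> * (v i - w i)" by (simp add: algebra_simps)
    then show ?thesis
      using square_add_le[OF assms, of "x i - \<gamma> * v i" "\<gamma> * (v i - w i)"]
      by (simp only: power_mult_distrib)
  qed
  then have "(\<Sum>i<m. (x i - \<gamma> * w i)\<^sup>2)
    \<le> (\<Sum>i<m. (1 + t) * (x i - \<gamma> * v i)\<^sup>2 + (1 + 1 / t) * (\<gamma>\<^sup>2 * (v i - w i)\<^sup>2))"
    by (intro sum_mono)
  then show ?thesis
    by (simp add: sqdist_def vscale_def sum.distrib sum_distrib_left)
qed

text \<open>Lets the main estimate work with strictly positive quantities, where the ratio b/a is
  defined, and recovers the degenerate cases by continuity.\<close>

lemma le_sqrt_add_if_le_perturbed: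
  fixes A B L :: real
  assumes "\<And>\<eta>. \<eta> > 0 \<Longrightarrow> L \<le> sqrt (A + \<eta>) + sqrt (B + \<eta>)"
  shows "L \<le> sqrt A + sqrt B"
proof (rule tendsto_lowerbound)
  have "((\<lambda>\<eta>. sqrt (A + \<eta>) + sqrt (B + \<eta>)) \<longlongrightarrow> sqrt (A + 0) + sqrt (B + 0)) (at_right 0)"
    by (intro tendsto_intros)
  then show "((\<lambda>\<eta>. sqrt (A + \<eta>) + sqrt (B + \<eta>)) \<longlongrightarrow> sqrt A + sqrt B) (at_right 0)"
    by simp
  show "\<forall>\<^sub>F \<eta> in at_right 0. L \<le> sqrt (A + \<eta>) + sqrt (B + \<eta>)"
    using assms by (auto simp: eventually_at_right_field intro: exI[of _ 1])
qed simp

text \<open>This is (K^(1 - \<epsilon>) / 2)^(2/m), the finite-blocklength counterpart of 2^(2R) in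
  the converse.\<close>

definition rate_factor :: "real \<Rightarrow> nat \<Rightarrow> real \<Rightarrow> real" where
  "rate_factor R m \<epsilon> = exp (2 / real m * ((1 - \<epsilon>) * ln (real (card (messages R m))) - ln 2))"

text \<open>The argument \<open>r\<close> stands for 2^(2R), so that one formula covers both a
  finite blocklength and the limit.\<close>

definition distortion_bound :: "real \<Rightarrow> real \<Rightarrow> real \<Rightarrow> real \<Rightarrow> real \<Rightarrow> real" where
  "distortion_bound \<sigma> P \<gamma> c r = 1 / \<gamma>\<^sup>2 * (pos_part (sqrt (\<sigma>\<^sup>2 * r / (1 + \<sigma>\<^sup>2 + P + 2 * c))
     - sqrt ((1 - \<gamma>)\<^sup>2 * \<sigma>\<^sup>2 + \<gamma>\<^sup>2 * P - 2 * \<gamma> * (1 - \<gamma>) * c)))\<^sup>2"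

section \<open>Second-moment identities and bounds at a fixed blocklength\<close>

context gaussian_code
begin

text \<open>The power actually spent. The identities below need its exact value; \<open>P\<close>
  enters afterwards by monotonicity.\<close>

definition pow :: real where
  "pow = (\<integral>\<omega>. sqdist m (x0 \<omega>) (x1 \<omega>) \<partial>J) / real m"

text \<open>As X1 = X0 + V and E|X0|^2 = m \<sigma>^2, this is the normalized correlation E<X0, V> /
  m, written without naming V.\<close>

definition cov :: real where
  "cov = (\<integral>\<omega>. vinner m (x0 \<omega>) (x1 \<omega>) \<partial>J) / real m - \<sigma>\<^sup>2"

lemma pow_le: "pow \<le> P"
  using sqdist_x0_x1(2) m_pos by (simp add: pow_def field_simps)

lemma integrable_vinner_x0_x1: "integrable J (\<lambda>\<omega>. vinner m (x0 \<omega>) (x1 \<omega>))"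
  and integrable_vinner_x0_z: "integrable J (\<lambda>\<omega>. vinner m (x0 \<omega>) (z \<omega>))"
  and integrable_vinner_x1_z: "integrable J (\<lambda>\<omega>. vinner m (x1 \<omega>) (z \<omega>))"
  using vinner_x0(1) vinner_z(1) integrable_vinner_x1
  by (auto intro!: integrable_vinner)

lemma integral_vinner_x0_x1: "(\<integral>\<omega>. vinner m (x0 \<omega>) (x1 \<omega>) \<partial>J) = real m * (cov + \<sigma>\<^sup>2)"
  using m_pos by (simp add: cov_def)

lemma integral_vinner_x1: "(\<integral>\<omega>. vinner m (x1 \<omega>) (x1 \<omega>) \<partial>J) = real m * (pow + 2 * cov + \<sigma>\<^sup>2)"
proof -
  have "real m * pow = (\<integral>\<omega>. sqdist m (x0 \<omega>) (x1 \<omega>) \<partial>J)"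
    using m_pos by (simp add: pow_def)
  also have "\<dots> = real m * \<sigma>\<^sup>2 - 2 * (real m * (cov + \<sigma>\<^sup>2)) + (\<integral>\<omega>. vinner m (x1 \<omega>) (x1 \<omega>) \<partial>J)"
    unfolding sqdist_eq_vinner
    using vinner_x0 integrable_vinner_x0_x1 integrable_vinner_x1 by (simp add: integral_vinner_x0_x1)
  finally show ?thesis by (simp add: algebra_simps)
qed

lemma sqdist_x0_vscale_x1:
  "integrable J (\<lambda>\<omega>. sqdist m (x0 \<omega>) (vscale m \<gamma> (x1 \<omega>)))"
  "(\<integral>\<omega>. sqdist m (x0 \<omega>) (vscale m \<gamma> (x1 \<omega>)) \<partial>J)
    = real m * ((1 - \<gamma>)\<^sup>2 * \<sigma>\<^sup>2 + \<gamma>\<^sup>2 * pow - 2 * \<gamma> * (1 - \<gamma>) * cov)"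
  unfolding sqdist_eq_vinner vinner_vscale_left vinner_vscale_right
  using vinner_x0 integrable_vinner_x0_x1 integrable_vinner_x1
  by (simp_all add: integral_vinner_x0_x1 integral_vinner_x1 power2_eq_square algebra_simps)

lemma vinner_y:
  "integrable J (\<lambda>\<omega>. vinner m (y \<omega>) (y \<omega>))"
  "(\<integral>\<omega>. vinner m (y \<omega>) (y \<omega>) \<partial>J) = real m * (1 + \<sigma>\<^sup>2 + pow + 2 * cov)"
proof -
  have *: "vinner m (y \<omega>) (y \<omega>)
     = vinner m (x1 \<omega>) (x1 \<omega>) + 2 * vinner m (x1 \<omega>) (z \<omega>) + vinner m (z \<omega>) (z \<omega>)" for \<omega>
    by (simp add: y_eq vinner_vadd_left vinner_vadd_right vinner_commute)
  note i = vinner_z integrable_vinner_x1_z integrable_vinner_x1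
  show "integrable J (\<lambda>\<omega>. vinner m (y \<omega>) (y \<omega>))"
    unfolding * using i by simp
  show "(\<integral>\<omega>. vinner m (y \<omega>) (y \<omega>) \<partial>J) = real m * (1 + \<sigma>\<^sup>2 + pow + 2 * cov)"
    unfolding * using i by (simp add: integral_vinner_x1 vinner_x1_z algebra_simps)
qed

lemma vinner_x0_y:
  "integrable J (\<lambda>\<omega>. vinner m (x0 \<omega>) (y \<omega>))"
  "(\<integral>\<omega>. vinner m (x0 \<omega>) (y \<omega>) \<partial>J) = real m * (cov + \<sigma>\<^sup>2)"
  unfolding y_eq vinner_vadd_right using integrable_vinner_x0_x1 integrable_vinner_x0_z
  by (simp_all add: integral_vinner_x0_x1 vinner_x0_z)

text \<open>The noise alone contributes 1. This makes the output power admissible as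
  \<open>S\<close> in the converse.\<close>

lemma output_power_ge_1: "1 + \<sigma>\<^sup>2 + pow + 2 * cov \<ge> 1"
proof -
  have "0 \<le> real m * (pow + 2 * cov + \<sigma>\<^sup>2)"
    unfolding integral_vinner_x1[symmetric] by (simp add: vinner_self_nonneg)
  then show ?thesis using m_pos by (simp add: zero_le_mult_iff)
qed

text \<open>Cauchy-Schwarz for host and added signal. It is read off from the nonnegative error of
  the best linear estimate of the input from the host, with regression coefficient
  \<open>a\<close>.\<close>

lemma cov_square_le: "cov\<^sup>2 \<le> \<sigma>\<^sup>2 * pow"
proof -
  define a where "a = (cov + \<sigma>\<^sup>2) / \<sigma>\<^sup>2"
  have \<sigma>2: "\<sigma>\<^sup>2 > 0" using \<sigma>_pos by simp
  have "0 \<le> (\<integral>\<omega>. sqdist m (x1 \<omega>) (vscale m a (x0 \<omega>)) \<partial>J)"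
    by simp
  also have "\<dots> = real m * (pow + 2 * cov + \<sigma>\<^sup>2 - 2 * a * (cov + \<sigma>\<^sup>2) + a\<^sup>2 * \<sigma>\<^sup>2)"
    unfolding sqdist_eq_vinner vinner_vscale_left vinner_vscale_right vinner_commute[of _ "x1 _" "x0 _"]
    using vinner_x0 integrable_vinner_x0_x1 integrable_vinner_x1
    by (simp add: integral_vinner_x0_x1 integral_vinner_x1 power2_eq_square algebra_simps)
  finally have "0 \<le> pow + 2 * cov + \<sigma>\<^sup>2 - 2 * a * (cov + \<sigma>\<^sup>2) + a\<^sup>2 * \<sigma>\<^sup>2"
    using m_pos by (simp add: zero_le_mult_iff)
  then have "0 \<le> \<sigma>\<^sup>2 * (pow + 2 * cov + \<sigma>\<^sup>2 - 2 * a * (cov + \<sigma>\<^sup>2) + a\<^sup>2 * \<sigma>\<^sup>2)"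
    using \<sigma>2 by simp
  also have "\<dots> = \<sigma>\<^sup>2 * (pow + 2 * cov + \<sigma>\<^sup>2) - 2 * (a * \<sigma>\<^sup>2) * (cov + \<sigma>\<^sup>2) + (a * \<sigma>\<^sup>2)\<^sup>2"
    by (simp add: power2_eq_square algebra_simps)
  also have "a * \<sigma>\<^sup>2 = cov + \<sigma>\<^sup>2"
    using \<sigma>2 by (simp add: a_def)
  finally show ?thesis by (simp add: power2_eq_square algebra_simps)
qed

text \<open>The zero estimate has error \<open>D\<close> = \<sigma>^2, which cancels and leaves a
  bound on the output power alone.\<close>

lemma rate_factor_le_output_power: "rate_factor R m err \<le> 1 + \<sigma>\<^sup>2 + pow + 2 * cov"
proof -
  have "\<sigma>\<^sup>2 * rate_factor R m err \<le> (1 + \<sigma>\<^sup>2 + pow + 2 * cov) * \<sigma>\<^sup>2"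
    unfolding rate_factor_def
    by (rule converse_inequality[where u="\<lambda>_. zero_vec m"])
      (use output_power_ge_1 \<sigma>_pos vinner_y vinner_x0 in \<open>auto simp: sqdist_zero_vec\<close>)
  then show ?thesis using \<sigma>_pos by (simp add: mult.commute)
qed

text \<open>With \<open>a\<close> the regression coefficient of the host on the output, s D =
  \<sigma>^2 (1 + pow) - cov^2 \<le> \<sigma>^2 (1 + P), so the factor \<sigma>^2 cancels and the
  host power disappears.\<close>

lemma rate_factor_le_power: "rate_factor R m err \<le> 1 + P"
proof -
  define s where "s = 1 + \<sigma>\<^sup>2 + pow + 2 * cov"
  define a where "a = (cov + \<sigma>\<^sup>2) / s"
  define D where "D = \<sigma>\<^sup>2 - 2 * a * (cov + \<sigma>\<^sup>2) + a\<^sup>2 * s"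
  have s: "s > 0" using output_power_ge_1 by (simp add: s_def)
  have \<sigma>2: "\<sigma>\<^sup>2 > 0" using \<sigma>_pos by simp
  have "a * s = cov + \<sigma>\<^sup>2" using s by (simp add: a_def)
  then have "s * D = \<sigma>\<^sup>2 * s - (cov + \<sigma>\<^sup>2)\<^sup>2"
    unfolding D_def by (simp add: power2_eq_square algebra_simps)
      (metis (no_types, opaque_lifting) distrib_left mult.left_commute mult.commute)
  then have sD: "s * D = \<sigma>\<^sup>2 * (1 + pow) - cov\<^sup>2"
    by (simp add: s_def power2_eq_square algebra_simps)
  \<comment> \<open>By Cauchy-Schwarz the product is at least \<sigma>^2; the converse needs
    \<open>D\<close> strictly positive.\<close>
  have "s * D > 0"
    using cov_square_le \<sigma>2 unfolding sD distrib_left by linarith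
  with s have D: "D > 0" by (simp add: zero_less_mult_iff)
  have "integrable J (\<lambda>\<omega>. sqdist m (x0 \<omega>) (vscale m a (y \<omega>)))"
    and "(\<integral>\<omega>. sqdist m (x0 \<omega>) (vscale m a (y \<omega>)) \<partial>J) = real m * D"
    unfolding sqdist_eq_vinner vinner_vscale_left vinner_vscale_right
    using vinner_x0 vinner_y vinner_x0_y
    by (simp_all add: D_def s_def power2_eq_square algebra_simps)
  then have "\<sigma>\<^sup>2 * rate_factor R m err \<le> s * D"
    unfolding rate_factor_def
    by (intro converse_inequality[where u="vscale m a"])
       (use s D vinner_y in \<open>auto simp: s_def intro!: measurable_vscale\<close>)
  also have "\<dots> \<le> \<sigma>\<^sup>2 * (1 + P)"
    using mult_left_mono[OF pow_le less_imp_le[OF \<sigma>2]] zero_le_power2[of cov]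
    unfolding sD distrib_left by linarith
  finally show ?thesis using \<sigma>2 by simp
qed

text \<open>If \<gamma> times the decoder's estimate of the input serves as host estimate, its root
  mean square error is at most that of \<gamma> X1 plus |\<gamma>| times the root of the distortion.
  The converse bounds the sum from below, and solving for the distortion gives the claim. Infinite
  distortion is trivial.\<close>

lemma distortion_bound_le:
  assumes \<gamma>: "\<gamma> \<noteq> 0"
  shows "ennreal (distortion_bound \<sigma> P \<gamma> cov (rate_factor R m err)) \<le> expected_distortion \<sigma> R m enc dec"
proof (cases "expected_distortion \<sigma> R m enc dec = \<infinity>")
  case False
  define d where "d = enn2real (expected_distortion \<sigma> R m enc dec)"
  have d: "expected_distortion \<sigma> R m enc dec = ennreal d" "d \<ge> 0"
    using False by (auto simp: d_def less_top)
  define s where "s = 1 + \<sigma>\<^sup>2 + P + 2 * cov"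
  define A where "A = (1 - \<gamma>)\<^sup>2 * \<sigma>\<^sup>2 + \<gamma>\<^sup>2 * P - 2 * \<gamma> * (1 - \<gamma>) * cov"
  define L where "L = sqrt (\<sigma>\<^sup>2 * rate_factor R m err / s)"
  have s: "s > 0" using output_power_ge_1 pow_le by (simp add: s_def)
  have [measurable]: "(\<lambda>\<omega>. xhat (y \<omega>)) \<in> J \<rightarrow>\<^sub>M Rm m" by measurable
  have "(\<integral>\<^sup>+\<omega>. ennreal (distortion m (x1 \<omega>) (xhat (y \<omega>))) \<partial>J) = ennreal d"
    using d by (simp add: expected_distortion_def)
  moreover have [measurable]: "(\<lambda>\<omega>. distortion m (x1 \<omega>) (xhat (y \<omega>))) \<in> borel_measurable J"
    unfolding distortion_def by measurable
  moreover have "AE \<omega> in J. 0 \<le> distortion m (x1 \<omega>) (xhat (y \<omega>))"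
    by (simp add: distortion_def)
  ultimately have id: "integrable J (\<lambda>\<omega>. distortion m (x1 \<omega>) (xhat (y \<omega>)))"
    and Ed: "(\<integral>\<omega>. distortion m (x1 \<omega>) (xhat (y \<omega>)) \<partial>J) = d"
    using d(2) by (auto simp: integral_eq_nn_integral intro: integrableI_nn_integral_finite)
  have sq: "sqdist m (x1 \<omega>) (xhat (y \<omega>)) = real m * distortion m (x1 \<omega>) (xhat (y \<omega>))" for \<omega>
    using m_pos by (simp add: distortion_def)
  have iB: "integrable J (\<lambda>\<omega>. sqdist m (x1 \<omega>) (xhat (y \<omega>)))"
    and EB: "(\<integral>\<omega>. sqdist m (x1 \<omega>) (xhat (y \<omega>)) \<partial>J) = real m * d"
    unfolding sq using id Ed by auto
  \<comment> \<open>\<open>Ap\<close> is the exact normalized error of \<gamma> X1 as an estimate of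
    the host; \<open>A\<close> is its bound with \<open>P\<close> in place of
    \<open>pow\<close>.\<close>
  define Ap where "Ap = (1 - \<gamma>)\<^sup>2 * \<sigma>\<^sup>2 + \<gamma>\<^sup>2 * pow - 2 * \<gamma> * (1 - \<gamma>) * cov"
  have "0 \<le> real m * Ap"
    unfolding Ap_def sqdist_x0_vscale_x1(2)[symmetric] by simp
  then have "0 \<le> Ap" using m_pos by (simp add: zero_le_mult_iff)
  moreover have "Ap \<le> A"
    using pow_le by (simp add: A_def Ap_def mult_left_mono)
  ultimately have A: "0 \<le> A" "Ap \<le> A" by auto
  have "L \<le> sqrt (A + \<eta>) + sqrt (\<gamma>\<^sup>2 * d + \<eta>)" if \<eta>: "\<eta> > 0" for \<eta>
  proof -
    define a b where "a = sqrt (A + \<eta>)" and "b = sqrt (\<gamma>\<^sup>2 * d + \<eta>)"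
    have ab: "a > 0" "b > 0" and a2: "a\<^sup>2 = A + \<eta>" and b2: "b\<^sup>2 = \<gamma>\<^sup>2 * d + \<eta>"
      using A(1) d(2) \<eta> by (auto simp: a_def b_def add_nonneg_pos)
    \<comment> \<open>The optimal weight in Young's inequality; the perturbation \<eta> keeps a and
      b positive.\<close>
    define t where "t = b / a"
    have t: "t > 0" using ab by (simp add: t_def)
    define W where "W \<omega> = (1 + t) * sqdist m (x0 \<omega>) (vscale m \<gamma> (x1 \<omega>))
      + (1 + 1 / t) * (\<gamma>\<^sup>2 * sqdist m (x1 \<omega>) (xhat (y \<omega>)))" for \<omega>
    have iW: "integrable J W"
      unfolding W_def using sqdist_x0_vscale_x1(1) iB by auto
    have le: "sqdist m (x0 \<omega>) (vscale m \<gamma> (xhat (y \<omega>))) \<le> W \<omega>" for \<omega>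
      unfolding W_def by (rule sqdist_vscale_triangle[OF t])
    have iD: "integrable J (\<lambda>\<omega>. sqdist m (x0 \<omega>) (vscale m \<gamma> (xhat (y \<omega>))))"
    proof (rule Bochner_Integration.integrable_bound[OF iW])
      show "(\<lambda>\<omega>. sqdist m (x0 \<omega>) (vscale m \<gamma> (xhat (y \<omega>)))) \<in> borel_measurable J"
        by measurable
      show "AE \<omega> in J. norm (sqdist m (x0 \<omega>) (vscale m \<gamma> (xhat (y \<omega>)))) \<le> norm (W \<omega>)"
        using order_trans[OF le abs_ge_self] by simp
    qed
    have "(\<integral>\<omega>. sqdist m (x0 \<omega>) (vscale m \<gamma> (xhat (y \<omega>))) \<partial>J) \<le> (\<integral>\<omega>. W \<omega> \<partial>J)"
      by (rule integral_mono[OF iD iW le])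
    also have "\<dots> = real m * ((1 + t) * Ap + (1 + 1 / t) * (\<gamma>\<^sup>2 * d))"
      unfolding W_def using sqdist_x0_vscale_x1(1) iB EB sqdist_x0_vscale_x1(2)[of \<gamma>, folded Ap_def]
      by (simp add: algebra_simps)
    also have "\<dots> \<le> real m * ((1 + t) * a\<^sup>2 + (1 + 1 / t) * b\<^sup>2)"
      unfolding a2 b2 using A(2) \<eta> t by (intro mult_left_mono add_mono) auto
    also have "(1 + t) * a\<^sup>2 + (1 + 1 / t) * b\<^sup>2 = (a + b)\<^sup>2"
      using ab by (simp add: t_def power2_eq_square field_simps)
    finally have ED: "(\<integral>\<omega>. sqdist m (x0 \<omega>) (vscale m \<gamma> (xhat (y \<omega>))) \<partial>J) \<le> real m * (a + b)\<^sup>2" .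
    have "\<sigma>\<^sup>2 * rate_factor R m err \<le> s * (a + b)\<^sup>2"
      unfolding rate_factor_def
    proof (rule converse_inequality[where u="\<lambda>v. vscale m \<gamma> (xhat v)"])
      show "(\<integral>\<omega>. vinner m (y \<omega>) (y \<omega>) \<partial>J) \<le> real m * s"
        unfolding vinner_y(2) s_def using pow_le by (intro mult_left_mono) auto
      show "(\<lambda>v. vscale m \<gamma> (xhat v)) \<in> Rm m \<rightarrow>\<^sub>M Rm m" by measurable
    qed (use s ab iD ED vinner_y(1) in \<open>auto intro: add_pos_pos\<close>)
    then have "\<sigma>\<^sup>2 * rate_factor R m err / s \<le> (a + b)\<^sup>2"
      using s by (simp add: field_simps)
    then have "L \<le> sqrt ((a + b)\<^sup>2)"
      unfolding L_def by (rule real_sqrt_le_mono)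
    then show ?thesis using ab by (simp add: a_def b_def)
  qed
  then have "L \<le> sqrt A + sqrt (\<gamma>\<^sup>2 * d)"
    by (rule le_sqrt_add_if_le_perturbed)
  \<comment> \<open>The right-hand side is nonnegative, so the bound survives taking the positive
    part and can then be squared.\<close>
  then have "pos_part (L - sqrt A) \<le> sqrt (\<gamma>\<^sup>2 * d)"
    using d(2) by (simp add: pos_part_def)
  then have "(pos_part (L - sqrt A))\<^sup>2 \<le> (sqrt (\<gamma>\<^sup>2 * d))\<^sup>2"
    by (intro power_mono) (simp_all add: pos_part_def)
  then have "(pos_part (L - sqrt A))\<^sup>2 \<le> \<gamma>\<^sup>2 * d"
    using d(2) by simp
  then have "1 / \<gamma>\<^sup>2 * (pos_part (L - sqrt A))\<^sup>2 \<le> d"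
    using \<gamma> by (simp add: divide_le_eq mult.commute)
  then show ?thesis
    unfolding d(1) by (intro ennreal_leI) (simp add: distortion_bound_def L_def A_def s_def)
qed simp

end

text \<open>One \<open>c\<close> serves for every \<gamma>. This uniformity is what puts the infimum
  outside the supremum in the final bound.\<close>

lemma (in gaussian_code) single_letter_bounds:
  "\<exists>c. c \<in> {- (\<sigma> * sqrt P) .. \<sigma> * sqrt P} \<and> rate_factor R m err \<le> 1 + \<sigma>\<^sup>2 + P + 2 * c \<and>
     (\<forall>\<gamma>. \<gamma> \<noteq> 0 \<longrightarrow> ennreal (distortion_bound \<sigma> P \<gamma> c (rate_factor R m err))
        \<le> expected_distortion \<sigma> R m enc dec)"
proof (intro exI[of _ cov] conjI allI impI)
  have "cov\<^sup>2 \<le> \<sigma>\<^sup>2 * P"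
    using cov_square_le pow_le by (meson mult_left_mono order_trans zero_le_power2)
  then have "\<bar>cov\<bar> \<le> sqrt (\<sigma>\<^sup>2 * P)"
    using real_sqrt_le_mono by fastforce
  then have "\<bar>cov\<bar> \<le> \<sigma> * sqrt P"
    using \<sigma>_pos by (simp add: real_sqrt_mult)
  then show "cov \<in> {- (\<sigma> * sqrt P) .. \<sigma> * sqrt P}" by auto
  show "rate_factor R m err \<le> 1 + \<sigma>\<^sup>2 + P + 2 * cov"
    using rate_factor_le_output_power pow_le by simp
qed (rule distortion_bound_le)

section \<open>Limits\<close>

lemma ln_card_messages:
  assumes "R \<ge> 0" "m \<ge> 1"
  shows "ln (real (card (messages R m))) / real m \<le> R * ln 2"
    and "R * ln 2 - ln 2 / real m \<le> ln (real (card (messages R m))) / real m"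
proof -
  define x :: real where "x = 2 powr (real m * R)"
  have x: "x \<ge> 1" unfolding x_def using assms by (simp add: ge_one_powr_ge_zero)
  then have c: "real (card (messages R m)) = of_int \<lfloor>x\<rfloor>"
    by (simp add: messages_def x_def)
  \<comment> \<open>For x \<ge> 1 rounding down loses at most a factor 2, hence at most ln 2 / m in
    the rate.\<close>
  have f: "of_int \<lfloor>x\<rfloor> \<ge> (1::real)" "of_int \<lfloor>x\<rfloor> \<le> x" "x / 2 \<le> of_int \<lfloor>x\<rfloor>"
    using x by (simp, simp, smt (verit) x field_sum_of_halves le_floor_iff of_int_1 real_of_int_floor_add_one_gt)
  have "ln (real_of_int \<lfloor>x\<rfloor>) \<le> ln x" "ln (x / 2) \<le> ln (real_of_int \<lfloor>x\<rfloor>)"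
    using f x by (auto intro!: ln_mono simp del: ln_le_cancel_iff)
  moreover have "ln x = real m * (R * ln 2)" by (simp add: x_def ln_powr)
  ultimately have "ln (real (card (messages R m))) \<le> real m * (R * ln 2)"
    and "real m * (R * ln 2) - ln 2 \<le> ln (real (card (messages R m)))"
    using x by (simp_all add: c ln_div)
  from this[THEN divide_right_mono, of "real m"]
  show "ln (real (card (messages R m))) / real m \<le> R * ln 2"
    and "R * ln 2 - ln 2 / real m \<le> ln (real (card (messages R m))) / real m"
    using assms(2) by (simp_all add: diff_divide_distrib)
qed

text \<open>Rounding the number of messages and mixing the message weights each cost a term of order
  1/m in the exponent, and the factor 1 - \<epsilon> tends to 1.\<close>

lemma rate_factor_tendsto:
  assumes "R \<ge> 0" and \<epsilon>: "\<epsilon> \<longlonglongrightarrow> 0"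
  shows "(\<lambda>m. rate_factor R m (\<epsilon> m)) \<longlonglongrightarrow> 2 powr (2 * R)"
proof -
  let ?l = "\<lambda>m. ln (real (card (messages R m))) / real m"
  have inv: "(\<lambda>m. ln 2 / real m) \<longlonglongrightarrow> 0"
    by (rule lim_const_over_n)
  have "?l \<longlonglongrightarrow> R * ln 2"
  proof (rule tendsto_sandwich[where h="\<lambda>_. R * ln 2"])
    show "(\<lambda>m. R * ln 2 - ln 2 / real m) \<longlonglongrightarrow> R * ln 2"
      using tendsto_diff[OF tendsto_const inv] by simp
  qed (auto intro!: eventually_sequentiallyI[of 1] ln_card_messages[OF assms(1)] tendsto_const)
  then have "(\<lambda>m. exp (2 * ((1 - \<epsilon> m) * ?l m - ln 2 / real m)))
      \<longlonglongrightarrow> exp (2 * ((1 - 0) * (R * ln 2) - 0))"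
    by (intro tendsto_intros inv \<epsilon>)
  moreover have "exp (2 * ((1 - 0) * (R * ln 2) - 0)) = 2 powr (2 * R)"
    by (simp add: powr_def)
  moreover have "rate_factor R m (\<epsilon> m) = exp (2 * ((1 - \<epsilon> m) * ?l m - ln 2 / real m))" for m
    by (simp add: rate_factor_def diff_divide_distrib)
  ultimately show ?thesis by simp
qed

lemma distortion_bound_tendsto:
  assumes c: "c \<longlonglongrightarrow> l" and r: "r \<longlonglongrightarrow> q" and "1 + \<sigma>\<^sup>2 + P + 2 * l \<noteq> 0"
  shows "(\<lambda>n. distortion_bound \<sigma> P \<gamma> (c n) (r n)) \<longlonglongrightarrow> distortion_bound \<sigma> P \<gamma> l q"
  unfolding distortion_bound_def pos_part_def
  by (intro tendsto_intros c r) (use assms in simp)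

theorem theorem1:
  fixes \<sigma> R P :: real
  assumes "\<sigma> > 0" and "R \<ge> 0" and "P \<ge> 0"
  shows "(P \<ge> 2 powr (2 * R) - 1 \<longrightarrow>
            MMSE \<sigma> P R \<ge>
              (INF \<sigma>XV\<in>{max (- \<sigma> * sqrt P) ((2 powr (2 * R) - 1 - P - \<sigma>\<^sup>2) / 2) .. \<sigma> * sqrt P}.
               SUP \<gamma>\<in>UNIV - {0::real}.
                 ennreal (1 / \<gamma>\<^sup>2 *
                   (pos_part (sqrt (\<sigma>\<^sup>2 * 2 powr (2 * R) / (1 + \<sigma>\<^sup>2 + P + 2 * \<sigma>XV))
                      - sqrt ((1 - \<gamma>)\<^sup>2 * \<sigma>\<^sup>2 + \<gamma>\<^sup>2 * P - 2 * \<gamma> * (1 - \<gamma>) * \<sigma>XV)))\<^sup>2)))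
       \<and> (P < 2 powr (2 * R) - 1 \<longrightarrow>
            \<not> (\<exists>enc dec.
                 (\<forall>m\<ge>1. is_encoder R m (enc m) \<and> is_decoder R m (dec m) \<and>
                        power_constraint \<sigma> P R m (enc m)) \<and>
                 (\<lambda>m. error_prob \<sigma> R m (enc m) (dec m)) \<longlonglongrightarrow> 0))"
  (is "(_ \<longrightarrow> ?bound \<le> _) \<and> (_ \<longrightarrow> ?unreliable)")
proof (intro conjI impI)
  show "?bound \<le> MMSE \<sigma> P R"
    unfolding MMSE_def
  proof (rule INF_greatest, clarify)
    fix enc dec assume rel: "(enc, dec) \<in> reliable_codes \<sigma> P R"
    then have code: "gaussian_code \<sigma> P R m (enc m) (dec m)" if "m \<ge> 1" for m
      using assms that by (auto simp: reliable_codes_def gaussian_code_def)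
    have err: "(\<lambda>m. error_prob \<sigma> R m (enc m) (dec m)) \<longlonglongrightarrow> 0"
      using rel by (simp add: reliable_codes_def)
    let ?D = "\<lambda>m. expected_distortion \<sigma> R m (enc m) (dec m)"
    let ?r = "\<lambda>m. rate_factor R m (error_prob \<sigma> R m (enc m) (dec m))"
    have r: "?r \<longlonglongrightarrow> 2 powr (2 * R)"
      by (rule rate_factor_tendsto[OF assms(2) err])
    \<comment> \<open>The index is shifted by \<open>Suc\<close> because codes are constrained only
      for m \<ge> 1.\<close>
    have "\<forall>n. \<exists>c. c \<in> {- (\<sigma> * sqrt P) .. \<sigma> * sqrt P} \<and> ?r (Suc n) \<le> 1 + \<sigma>\<^sup>2 + P + 2 * c \<and>
       (\<forall>\<gamma>. \<gamma> \<noteq> 0 \<longrightarrow> ennreal (distortion_bound \<sigma> P \<gamma> c (?r (Suc n))) \<le> ?D (Suc n))"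
      using gaussian_code.single_letter_bounds[OF code] by auto
    then obtain c where c: "\<And>n. c n \<in> {- (\<sigma> * sqrt P) .. \<sigma> * sqrt P}"
      "\<And>n. ?r (Suc n) \<le> 1 + \<sigma>\<^sup>2 + P + 2 * c n"
      "\<And>n \<gamma>. \<gamma> \<noteq> 0 \<Longrightarrow> ennreal (distortion_bound \<sigma> P \<gamma> (c n) (?r (Suc n))) \<le> ?D (Suc n)"
      by metis
    \<comment> \<open>The correlations lie in a compact interval, so a subsequence converges; its
      limit is the witness for the infimum.\<close>
    obtain l s where l: "l \<in> {- (\<sigma> * sqrt P) .. \<sigma> * sqrt P}" and s: "strict_mono s"
      and cl: "(c \<circ> s) \<longlonglongrightarrow> l"
      using c(1) compact_imp_seq_compact[OF compact_Icc] unfolding seq_compact_def by metis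
    have s': "strict_mono (Suc \<circ> s)"
      using s by (simp add: strict_mono_def)
    have rs: "(\<lambda>n. ?r (Suc (s n))) \<longlonglongrightarrow> 2 powr (2 * R)"
      using LIMSEQ_subseq_LIMSEQ[OF r s'] by (simp add: comp_def)
    have "(\<lambda>n. 1 + \<sigma>\<^sup>2 + P + 2 * c (s n)) \<longlonglongrightarrow> 1 + \<sigma>\<^sup>2 + P + 2 * l"
      using cl by (intro tendsto_intros) (simp add: comp_def)
    \<comment> \<open>This is the remaining lower constraint on the correlation, and it keeps the
      denominator in the limit away from 0.\<close>
    with rs have le: "2 powr (2 * R) \<le> 1 + \<sigma>\<^sup>2 + P + 2 * l"
      by (rule LIMSEQ_le) (use c(2) in auto)
    then have nz: "1 + \<sigma>\<^sup>2 + P + 2 * l \<noteq> 0"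
      using powr_gt_zero[of 2 "2 * R"] by linarith
    \<comment> \<open>The subsequence is the same for all \<gamma>; along it the bounds converge,
      and the limsup of the distortions does not exceed that of the full sequence.\<close>
    have "ennreal (distortion_bound \<sigma> P \<gamma> l (2 powr (2 * R))) \<le> limsup ?D" if "\<gamma> \<noteq> 0" for \<gamma>
    proof -
      have "(\<lambda>n. ennreal (distortion_bound \<sigma> P \<gamma> (c (s n)) (?r (Suc (s n)))))
          \<longlonglongrightarrow> ennreal (distortion_bound \<sigma> P \<gamma> l (2 powr (2 * R)))"
        using cl rs nz by (intro tendsto_ennrealI distortion_bound_tendsto) (simp_all add: comp_def)
      then have "ennreal (distortion_bound \<sigma> P \<gamma> l (2 powr (2 * R)))
          = limsup (\<lambda>n. ennreal (distortion_bound \<sigma> P \<gamma> (c (s n)) (?r (Suc (s n)))))"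
        by (intro lim_imp_Limsup[symmetric]) auto
      also have "\<dots> \<le> limsup (?D \<circ> (Suc \<circ> s))"
        using c(3)[OF that] by (intro Limsup_mono) simp
      also have "\<dots> \<le> limsup ?D"
        by (rule limsup_subseq_mono[OF s'])
      finally show ?thesis .
    qed
    then show "?bound \<le> limsup ?D"
      using l le by (intro INF_lower2[of l] SUP_least) (auto simp: distortion_bound_def)
  qed
next
  assume P: "P < 2 powr (2 * R) - 1"
  show ?unreliable
  proof clarify
    fix enc dec
    assume code: "\<forall>m\<ge>1. is_encoder R m (enc m) \<and> is_decoder R m (dec m) \<and>
        power_constraint \<sigma> P R m (enc m)"
      and err: "(\<lambda>m. error_prob \<sigma> R m (enc m) (dec m)) \<longlonglongrightarrow> 0"
    \<comment> \<open>The bound holds at every positive blocklength, so its limit contradicts P <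
      2^(2R) - 1.\<close>
    have "rate_factor R m (error_prob \<sigma> R m (enc m) (dec m)) \<le> 1 + P" if "m \<ge> 1" for m
      using code assms that by (intro gaussian_code.rate_factor_le_power) (simp add: gaussian_code_def)
    with rate_factor_tendsto[OF assms(2) err] have "2 powr (2 * R) \<le> 1 + P"
      by (intro LIMSEQ_le_const2) auto
    with P show False by simp
  qed
qed

end
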